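(* For every $n$-dimensional generalized real Bott manifold $M^n$ there is an $n\times n$ binary matrix $A$ with zero diagonal such that (i) the facets-pairing structure $\mathcal{F}_A$ on $\mathcal{C}^n$ is strong, and (ii) the seal space $Q^n_{\mathcal{F}_A}$ is homeomorphic to $M^n$.
   Context: A generalized real Bott manifold is a manifold $M^n=B_m$ admitting a sequence of fiber bundles $B_m\to B_{m-1}\to\dots\to B_1\to B_0=\{\mathrm{pt}\}$ where each $B_i$ is the projectivization of a Whitney sum of finitely many real line bundles over $B_{i-1}$. $\mathcal{C}^n=\{x\in\mathbb{R}^n: -\tfrac14\le x_i\le\tfrac14\}$; $\mathbf{F}(i)$, $\mathbf{F}(-i)$ ($1\le i\le n$) are the facets in $\{x_i=\tfrac14\}$, $\{x_i=-\tfrac14\}$. Binary matrices have entries in $\mathbb{Z}_2$; $A^i_k$ denotes the $(i,k)$ entry as $0$ or $1$. $\mathcal{F}_A$ pairs $\mathbf{F}(j)$ with $\mathbf{F}(-j)$ via $\tau^A_j:\mathbf{F}(j)\to\mathbf{F}(-j)$, $\tau^A_j(x)=y$ with $y_{|j|}=-x_{|j|}$ and $y_k=(-1)^{A^{|j|}_k}x_k$ for $k\ne|j|$. $Q^n_{\mathcal{F}_A}$ is the quotient of $\mathcal{C}^n$ by the equivalence relation generated by $x\sim\tau^A_j(x)$. A composition $\tau^A_{k_m}\circ\dots\circ\tau^A_{k_1}$ applied to a proper face $f$ is valid if $f\subset\mathbf{F}(k_1)$ and $\tau^A_{k_i}\circ\dots\circ\tau^A_{k_1}(f)\subset\mathbf{F}(k_{i+1})$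 for $1\le i<m$ ($m=0$ allowed). For a proper face $f$ let $\Xi(f)$ be the set of facets containing $f$; if $f\subset\mathbf{F}(k)$ and $f'=\tau^A_k(f)$, define $\Psi^f_k:\Xi(f)\to\Xi(f')$ by $\Psi^f_k(\mathbf{F}(k))=\mathbf{F}(-k)$ and, for other $F'\in\Xi(f)$, $\Psi^f_k(F')$ is the facet $G$ with $G\cap\mathbf{F}(-k)=\tau^A_k(F'\cap\mathbf{F}(k))$. $\mathcal{F}_A$ is strong if for every proper face $f$ and any two valid compositions mapping $f$ onto the same face $\widetilde f$: (a) they agree at every point of $f$; and (b) the corresponding composites of the maps $\Psi$ coincide as maps $\Xi(f)\to\Xi(\widetilde f)$. *)

theory Defs
  imports "HOL-Analysis.Analysis"
begin

definition unit_sphere :: "nat \<Rightarrow> (nat \<Rightarrow> real) set" where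
  "unit_sphere k = {v. (\<forall>i\<ge>k. v i = 0) \<and> (\<Sum>i<k. (v i)\<^sup>2) = 1}"

definition normalize_vec :: "nat \<Rightarrow> (nat \<Rightarrow> real) \<Rightarrow> (nat \<Rightarrow> real)" where
  "normalize_vec k v = (\<lambda>j. v j / sqrt (\<Sum>i<k. (v i)\<^sup>2))"

text \<open>M, with projection p onto B, is (isomorphic as a bundle to) the projectivization
  P(L_1 + ... + L_k) of a Whitney sum of k real line bundles over B.  The line bundles are
  given by transition cocycles g U V b j (j < k) on an open cover of B; the projectivized
  sum is obtained by gluing the local pieces U x RP^(k-1), where U x RP^(k-1) is presented
  as the quotient of U x S^(k-1) by v ~ -v (via the quotient maps h U).\<close>
definition proj_whitney_bundle ::
  "'a topology \<Rightarrow> 'a topology \<Rightarrow> nat \<Rightarrow> ('a \<Rightarrow> 'a) \<Rightarrow> bool" where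
  "proj_whitney_bundle M B k p \<longleftrightarrow>
     k \<ge> 1 \<and> continuous_map M B p \<and> p ` topspace M = topspace B \<and>
     (\<exists>(\<U>::'a set set) (h::'a set \<Rightarrow> 'a \<times> (nat \<Rightarrow> real) \<Rightarrow> 'a)
        (g::'a set \<Rightarrow> 'a set \<Rightarrow> 'a \<Rightarrow> nat \<Rightarrow> real).
        (\<forall>U\<in>\<U>. openin B U) \<and> \<Union>\<U> = topspace B \<and>
        (\<forall>U\<in>\<U>.
           quotient_map (prod_topology (subtopology B U) (top_of_set (unit_sphere k)))
                        (subtopology M {x \<in> topspace M. p x \<in> U}) (h U) \<and>
           (\<forall>b\<in>U. \<forall>v\<in>unit_sphere k. p (h U (b, v)) = b) \<and>
           (\<forall>b\<in>U. \<forall>v\<in>unit_sphere k. \<forall>w\<in>unit_sphere k.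
               h U (b, v) = h U (b, w) \<longleftrightarrow> (w = v \<or> w = (\<lambda>j. - v j)))) \<and>
        (\<forall>U\<in>\<U>. \<forall>V\<in>\<U>. \<forall>j<k.
           continuous_map (subtopology B (U \<inter> V)) euclideanreal (\<lambda>b. g U V b j) \<and>
           (\<forall>b\<in>U \<inter> V. g U V b j \<noteq> 0)) \<and>
        (\<forall>U\<in>\<U>. \<forall>V\<in>\<U>. \<forall>W\<in>\<U>. \<forall>b\<in>U \<inter> V \<inter> W. \<forall>j<k.
           g U V b j * g V W b j = g U W b j) \<and>
        (\<forall>U\<in>\<U>. \<forall>b\<in>U. \<forall>j<k. g U U b j = 1) \<and>
        (\<forall>U\<in>\<U>. \<forall>V\<in>\<U>. \<forall>b\<in>U \<inter> V. \<forall>v\<in>unit_sphere k.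
           h V (b, v) = h U (b, normalize_vec k (\<lambda>j. g U V b j * v j))))"

definition gen_real_bott :: "nat \<Rightarrow> 'a topology \<Rightarrow> bool" where
  "gen_real_bott n M \<longleftrightarrow>
     (\<exists>(m::nat) (B::nat \<Rightarrow> 'a topology) (k::nat \<Rightarrow> nat) (p::nat \<Rightarrow> 'a \<Rightarrow> 'a).
        (\<exists>pt. topspace (B 0) = {pt}) \<and> B m = M \<and>
        (\<forall>i<m. proj_whitney_bundle (B (Suc i)) (B i) (k i) (p i)) \<and>
        n = (\<Sum>i<m. k i - 1))"

text \<open>Coordinates are indexed 0..n-1 (paper: 1..n). A signed index (i, True) stands for i,
  (i, False) for -i. Binary matrices: A i k = True means the entry is 1.\<close>
definition cube :: "nat \<Rightarrow> (nat \<Rightarrow> real) set" where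
  "cube n = {x. (\<forall>i<n. - 1/4 \<le> x i \<and> x i \<le> 1/4) \<and> (\<forall>i\<ge>n. x i = 0)}"

definition facet :: "nat \<Rightarrow> nat \<times> bool \<Rightarrow> (nat \<Rightarrow> real) set" where
  "facet n j = {x \<in> cube n. x (fst j) = (if snd j then 1/4 else - 1/4)}"

definition opp :: "nat \<times> bool \<Rightarrow> nat \<times> bool" where
  "opp j = (fst j, \<not> snd j)"

definition tau :: "(nat \<Rightarrow> nat \<Rightarrow> bool) \<Rightarrow> nat \<times> bool \<Rightarrow> (nat \<Rightarrow> real) \<Rightarrow> (nat \<Rightarrow> real)" where
  "tau A j x = (\<lambda>k. if k = fst j then - x k else if A (fst j) k then - x k else x k)"

definition proper_face :: "nat \<Rightarrow> (nat \<Rightarrow> real) set \<Rightarrow> bool" where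
  "proper_face n f \<longleftrightarrow> (\<exists>I \<epsilon>. I \<subseteq> {..<n} \<and> I \<noteq> {} \<and>
      f = {x \<in> cube n. \<forall>i\<in>I. x i = (if \<epsilon> i then 1/4 else - 1/4)})"

fun tau_comp :: "(nat \<Rightarrow> nat \<Rightarrow> bool) \<Rightarrow> (nat \<times> bool) list \<Rightarrow> (nat \<Rightarrow> real) \<Rightarrow> (nat \<Rightarrow> real)" where
  "tau_comp A [] x = x"
| "tau_comp A (k # ks) x = tau_comp A ks (tau A k x)"

fun valid_comp :: "nat \<Rightarrow> (nat \<Rightarrow> nat \<Rightarrow> bool) \<Rightarrow> (nat \<Rightarrow> real) set \<Rightarrow> (nat \<times> bool) list \<Rightarrow> bool" where
  "valid_comp n A f [] = True"
| "valid_comp n A f (k # ks) = (fst k < n \<and> f \<subseteq> facet n k \<and> valid_comp n A (tau A k ` f) ks)"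

definition Xi :: "nat \<Rightarrow> (nat \<Rightarrow> real) set \<Rightarrow> (nat \<times> bool) set" where
  "Xi n f = {j. fst j < n \<and> f \<subseteq> facet n j}"

definition Psi :: "nat \<Rightarrow> (nat \<Rightarrow> nat \<Rightarrow> bool) \<Rightarrow> nat \<times> bool \<Rightarrow> nat \<times> bool \<Rightarrow> nat \<times> bool" where
  "Psi n A k F' = (if F' = k then opp k
     else (THE G. fst G < n \<and> facet n G \<inter> facet n (opp k) = tau A k ` (facet n F' \<inter> facet n k)))"

fun Psi_comp :: "nat \<Rightarrow> (nat \<Rightarrow> nat \<Rightarrow> bool) \<Rightarrow> (nat \<times> bool) list \<Rightarrow> nat \<times> bool \<Rightarrow> nat \<times> bool" where
  "Psi_comp n A [] F = F"
| "Psi_comp n A (k # ks) F = Psi_comp n A ks (Psi n A k F)"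

definition strong_pairing :: "nat \<Rightarrow> (nat \<Rightarrow> nat \<Rightarrow> bool) \<Rightarrow> bool" where
  "strong_pairing n A \<longleftrightarrow>
     (\<forall>f ks1 ks2. proper_face n f \<and> valid_comp n A f ks1 \<and> valid_comp n A f ks2 \<and>
        tau_comp A ks1 ` f = tau_comp A ks2 ` f \<longrightarrow>
        (\<forall>x\<in>f. tau_comp A ks1 x = tau_comp A ks2 x) \<and>
        (\<forall>F\<in>Xi n f. Psi_comp n A ks1 F = Psi_comp n A ks2 F))"

definition pair_rel :: "nat \<Rightarrow> (nat \<Rightarrow> nat \<Rightarrow> bool) \<Rightarrow> ((nat \<Rightarrow> real) \<times> (nat \<Rightarrow> real)) set" where
  "pair_rel n A = (let S = {(x, tau A j x) | x j. fst j < n \<and> x \<in> facet n j}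
                   in Id_on (cube n) \<union> (S \<union> S\<inverse>)\<^sup>+)"

definition seal_space :: "nat \<Rightarrow> (nat \<Rightarrow> nat \<Rightarrow> bool) \<Rightarrow> (nat \<Rightarrow> real) set topology" where
  "seal_space n A = topology (\<lambda>S. S \<subseteq> cube n // pair_rel n A \<and>
                                  openin (top_of_set (cube n)) (\<Union>S))"

end

theory Submission
  imports Defs
begin

text \<open>
  By induction along the tower, each stage \<open>B\<close> is compact Hausdorff and is the quotient of a cube
  by the relation generated by the pairing of some block triangular matrix.  Along the quotient map
  \<open>q\<close> from the cube to \<open>B\<close> the line bundles become trivial, so after introducing a bundle metric
  the pulled-back orthonormal frames, unique up to constant signs, extend over the whole cube; comparing
  them across a pair of facets yields one sign per line bundle.  These signs, normalized at the last
  line bundle (which projectivization permits), are the new entries in the rows of the old facets.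
  The fibre \<open>RP\<^sup>k\<^sup>-\<^sup>1\<close> is a hemisphere, i.e. a cube, with antipodal boundary points identified,
  which contributes a diagonal block of ones.

  Strongness only uses the block structure: with ones put on the diagonal, rows in one block agree
  (at a common point of two facets of one block both pairings are the same map, which forces equal
  signs), and a composition of pairings flips coordinates by a sum of rows.
\<close>

section \<open>Sign changes\<close>

text \<open>The stages are given only through local presentations, so the Hausdorff property has to
  travel through the induction together with the matrix. Three steps rest on it: the bundle metric,
  for which compactness and the Hausdorff property provide separating functions; the closedness of
  the set where two frame fields agree; and the passage from a continuous surjection of the cube to
  a quotient map. A line bundle is never handled as an object. An orthonormal frame is replaced by
  the map that it induces from the sphere onto the projectivized fibre, and such a map sees the
  signs of the frame only up to a common factor. Hence each comparison of frames yields two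
  alternatives, and one sign may be prescribed. The last sign is the right one to prescribe because
  the hemisphere is cut out by the last coordinate being nonnegative: a sign change that fixes this
  coordinate preserves the hemisphere and becomes a sign change of the cube.\<close>

definition flip :: "(nat \<Rightarrow> bool) \<Rightarrow> (nat \<Rightarrow> real) \<Rightarrow> nat \<Rightarrow> real" where
  "flip s v = (\<lambda>i. if s i then - v i else v i)"

text \<open>Row \<open>j\<close> of the matrix with the diagonal filled by ones: \<open>\<tau>\<^sup>A\<close> at a facet of index \<open>j\<close>
  negates exactly the coordinates marked by this row.\<close>
definition tau_row :: "(nat \<Rightarrow> nat \<Rightarrow> bool) \<Rightarrow> nat \<Rightarrow> nat \<Rightarrow> bool" where
  "tau_row A j k \<longleftrightarrow> k = j \<or> A j k"

text \<open>\<open>bl\<close> names the stage of the tower at which a coordinate appears; it is an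
  arbitrary labelling, so that nothing has to be said about intervals of indices. As
  \<open>tau_row\<close> has ones on the diagonal, equal rows within a block force it to be one on
  the whole diagonal block.\<close>

definition block_triangular :: "nat \<Rightarrow> (nat \<Rightarrow> nat \<Rightarrow> bool) \<Rightarrow> (nat \<Rightarrow> nat) \<Rightarrow> bool" where
  "block_triangular n A bl \<longleftrightarrow>
     (\<forall>i<n. \<forall>j<n. (bl i = bl j \<longrightarrow> (\<forall>k<n. tau_row A i k = tau_row A j k)) \<and>
                  (bl j < bl i \<longrightarrow> \<not> A i j))"

lemma flip_apply: "flip s v i = (if s i then - v i else v i)"
  by (simp add: flip_def)

lemma flip_flip: "flip s (flip t v) = flip (\<lambda>i. s i \<noteq> t i) v"
  by (auto simp: flip_def)

lemma flip_flip_self [simp]: "flip s (flip s v) = v"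
  by (auto simp: flip_def)

lemma flip_uminus: "flip s (\<lambda>i. - v i) = (\<lambda>i. - flip s v i)"
  by (auto simp: flip_def)

lemma flip_False [simp]: "flip (\<lambda>i. False) v = v"
  by (simp add: flip_def)

lemma tau_eq_flip: "tau A j = flip (tau_row A (fst j))"
  by (auto simp: tau_def flip_def tau_row_def fun_eq_iff)

lemma flip_in_cube: "x \<in> cube n \<Longrightarrow> flip s x \<in> cube n"
  by (auto simp: cube_def flip_def)

lemma tau_in_facet: "x \<in> facet n j \<Longrightarrow> tau A j x \<in> facet n (opp j)"
  by (auto simp: facet_def opp_def tau_eq_flip flip_in_cube) (auto simp: flip_def tau_row_def)

lemma opp_opp [simp]: "opp (opp j) = j"
  by (simp add: opp_def)

lemma fst_opp [simp]: "fst (opp j) = fst j"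
  by (simp add: opp_def)

lemma tau_tau [simp]: "tau A (opp j) (tau A j x) = x"
  by (simp add: tau_eq_flip)

section \<open>Strongness of block triangular matrices\<close>

text \<open>Sign changes commute, so a composition of pairings is determined by the parity with
  which each coordinate is negated; the order of the list is immaterial.\<close>

definition flips :: "(nat \<Rightarrow> nat \<Rightarrow> bool) \<Rightarrow> (nat \<times> bool) list \<Rightarrow> nat \<Rightarrow> bool" where
  "flips A ks i \<longleftrightarrow> odd (length (filter (\<lambda>k. tau_row A (fst k) i) ks))"

lemma tau_comp_eq_flip: "tau_comp A ks = flip (flips A ks)"
proof (rule ext)
  show "tau_comp A ks x = flip (flips A ks) x" for x
  proof (induction ks arbitrary: x)
    case Nil
    then show ?case by (auto simp: flips_def flip_def)
  next
    case (Cons k ks)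
    then show ?case by (auto simp: flips_def flip_def tau_eq_flip)
  qed
qed

text \<open>Faces with their index set and signs exposed; values of \<open>e\<close> outside
  \<open>I\<close> carry no meaning. A sign change keeps \<open>I\<close> and alters only
  \<open>e\<close>, which turns statements about faces into statements about signs.\<close>

definition cface :: "nat \<Rightarrow> nat set \<Rightarrow> (nat \<Rightarrow> bool) \<Rightarrow> (nat \<Rightarrow> real) set" where
  "cface n I e = {x \<in> cube n. \<forall>i\<in>I. x i = (if e i then 1/4 else - 1/4)}"

lemma cface_witness:
  assumes "I \<subseteq> {..<n}"
  shows "(\<lambda>i. if i \<in> I then (if e i then 1/4 else - 1/4) else 0) \<in> cface n I e"
  using assms by (auto simp: cface_def cube_def)

lemma cface_subset_facet_iff:
  assumes "I \<subseteq> {..<n}"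
  shows "cface n I e \<subseteq> facet n (i, s) \<longleftrightarrow> i \<in> I \<and> e i = s"
proof
  assume "cface n I e \<subseteq> facet n (i, s)"
  then have "(\<lambda>i. if i \<in> I then (if e i then 1/4 else - 1/4) else 0) \<in> facet n (i, s)"
    using cface_witness[OF assms] by blast
  then show "i \<in> I \<and> e i = s" by (auto simp: facet_def split: if_splits)
qed (auto simp: cface_def facet_def)

lemma flip_image_cface: "flip t ` cface n I e = cface n I (\<lambda>i. e i \<noteq> t i)"
proof
  show "flip t ` cface n I e \<subseteq> cface n I (\<lambda>i. e i \<noteq> t i)"
    by (auto simp: cface_def flip_in_cube flip_apply)
  show "cface n I (\<lambda>i. e i \<noteq> t i) \<subseteq> flip t ` cface n I e"
  proof
    fix y assume y: "y \<in> cface n I (\<lambda>i. e i \<noteq> t i)"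
    then have "flip t y \<in> cface n I e" by (auto simp: cface_def flip_in_cube flip_apply)
    moreover have "y = flip t (flip t y)" by simp
    ultimately show "y \<in> flip t ` cface n I e" by blast
  qed
qed

lemma cface_eqD:
  assumes "I \<subseteq> {..<n}" "cface n I e = cface n I e'" "i \<in> I"
  shows "e i = e' i"
  using cface_subset_facet_iff[OF assms(1), of e i "e i"]
    cface_subset_facet_iff[OF assms(1), of e' i "e i"] assms by auto

text \<open>Sign changes preserve \<open>I\<close>, so every intermediate face fixes exactly the
  coordinates in \<open>I\<close>, and a facet containing it has its index there.\<close>

lemma valid_comp_cface:
  assumes "I \<subseteq> {..<n}" "valid_comp n A (cface n I e) ks"
  shows "fst ` set ks \<subseteq> I"
  using assms(2)
proof (induction ks arbitrary: e)
  case (Cons k ks)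
  then have "fst k \<in> I" using cface_subset_facet_iff[OF assms(1), of e "fst k" "snd k"] by simp
  moreover have "fst ` set ks \<subseteq> I"
    using Cons.IH[of "\<lambda>i. e i \<noteq> tau_row A (fst k) i"] Cons.prems
    by (simp add: tau_eq_flip flip_image_cface)
  ultimately show ?case by simp
qed simp

text \<open>This is the uniqueness behind \<open>THE\<close> in \<open>Psi\<close>. The intersection
  fixes exactly the coordinates \<open>i\<close> and \<open>k\<close>, so a facet containing it has
  one of these indices; index \<open>k\<close> would make the intersection all of
  \<open>facet n (k, t)\<close>.\<close>

lemma facet_Int_facet_inject:
  assumes "i < n" "i \<noteq> k" "k < n" "fst G < n" "facet n G \<inter> facet n (k, t) = facet n (i, s) \<inter> facet n (k, t)"
  shows "G = (i, s)"
proof -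
  let ?e = "\<lambda>j. if j = i then s else t"
  have "facet n (i, s) \<inter> facet n (k, t) = cface n {i, k} ?e"
    using assms by (auto simp: facet_def cface_def)
  then have "cface n {i, k} ?e \<subseteq> facet n (fst G, snd G)" unfolding prod.collapse using assms(5) by blast
  then have G: "fst G \<in> {i, k}" "?e (fst G) = snd G"
    using cface_subset_facet_iff[of "{i,k}" n ?e "fst G" "snd G"] assms by auto
  show ?thesis
  proof (cases "fst G = k")
    case True
    then have "facet n G = facet n (k, t)" using G assms by (cases G) auto
    then have "facet n (k, t) \<subseteq> facet n (i, s)" using assms by auto
    moreover have "facet n (k, t) = cface n {k} (\<lambda>_. t)" by (auto simp: facet_def cface_def)
    ultimately have "i \<in> {k}" using cface_subset_facet_iff[of "{k}" n "\<lambda>_. t" i s] assms by simp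
    then show ?thesis using assms by simp
  next
    case False
    then show ?thesis using G assms by (cases G) auto
  qed
qed

text \<open>The last assumption excludes the facet opposite to \<open>(k, t)\<close>, which does not
  meet it. For \<open>i = k\<close> the one on the diagonal of \<open>tau_row\<close> turns the
  formula into \<open>opp\<close>, so both clauses of \<open>Psi\<close> share one formula.\<close>

lemma Psi_eq:
  assumes "k < n" "i < n" "i \<noteq> k \<or> s = t"
  shows "Psi n A (k, t) (i, s) = (i, s \<noteq> tau_row A k i)"
proof (cases "i = k")
  case True
  then show ?thesis using assms by (auto simp: Psi_def opp_def tau_row_def)
next
  case False
  let ?e = "\<lambda>j. if j = i then s else t"
  have 1: "facet n (i, s) \<inter> facet n (k, t) = cface n {i, k} ?e"
    using False by (auto simp: facet_def cface_def)
  have 2: "facet n (i, s \<noteq> tau_row A k i) \<inter> facet n (opp (k, t)) = cface n {i, k} (\<lambda>j. ?e j \<noteq> tau_row A k j)"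
    using False by (auto simp: facet_def cface_def opp_def tau_row_def)
  have 3: "tau A (k, t) ` (facet n (i, s) \<inter> facet n (k, t)) =
      facet n (i, s \<noteq> tau_row A k i) \<inter> facet n (opp (k, t))"
    unfolding 1 2 tau_eq_flip flip_image_cface by simp
  have "(THE G. fst G < n \<and> facet n G \<inter> facet n (opp (k, t)) =
           tau A (k, t) ` (facet n (i, s) \<inter> facet n (k, t))) = (i, s \<noteq> tau_row A k i)"
  proof (rule the_equality)
    fix G :: "nat \<times> bool"
    assume "fst G < n \<and> facet n G \<inter> facet n (opp (k, t)) = tau A (k, t) ` (facet n (i, s) \<inter> facet n (k, t))"
    then show "G = (i, s \<noteq> tau_row A k i)"
      unfolding 3 opp_def using facet_Int_facet_inject[OF assms(2) False assms(1), of G "\<not> t"] by simp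
  qed (use 3 assms in auto)
  then show ?thesis using False by (simp add: Psi_def)
qed

text \<open>The transported facets depend only on parities at coordinates in \<open>I\<close>. These
  are already visible in the signs of the final face, so the agreement of facet maps demanded by
  strongness is automatic.\<close>

lemma Psi_comp_eq:
  assumes "I \<subseteq> {..<n}" "valid_comp n A (cface n I e) ks" "i \<in> I"
  shows "Psi_comp n A ks (i, e i) = (i, e i \<noteq> flips A ks i)"
  using assms(2)
proof (induction ks arbitrary: e)
  case Nil
  then show ?case by (simp add: flips_def)
next
  case (Cons k ks)
  obtain a t where k: "k = (a, t)" by fastforce
  have a: "a \<in> I" "e a = t"
    using Cons(2) cface_subset_facet_iff[OF assms(1), of e a t] by (auto simp: k)
  have P: "Psi n A k (i, e i) = (i, e i \<noteq> tau_row A a i)"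
    unfolding k using a assms by (intro Psi_eq) auto
  have "Psi_comp n A ks (i, e i \<noteq> tau_row A a i) = (i, (e i \<noteq> tau_row A a i) \<noteq> flips A ks i)"
    using Cons(1)[of "\<lambda>i. e i \<noteq> tau_row A a i"] Cons(2) by (simp add: k tau_eq_flip flip_image_cface)
  then show ?case using P by (auto simp: flips_def k)
qed

text \<open>Split the list by the value of \<open>bl\<close>: \<open>P\<close> holds for all entries
  of a class or for none, so every class contributes an even number.\<close>

lemma even_length_filter_of_classes:
  fixes bl :: "'b \<Rightarrow> nat"
  assumes P: "\<And>x y. x \<in> set L \<Longrightarrow> y \<in> set L \<Longrightarrow> bl x = bl y \<Longrightarrow> P x = P y"
    and ev: "\<And>x. x \<in> set L \<Longrightarrow> P x \<Longrightarrow> even (length (filter (\<lambda>y. bl y = bl x) L))"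
  shows "even (length (filter P L))"
proof -
  have "length (filter P L) = (\<Sum>b\<in>bl ` set L. length (filter (\<lambda>y. P y \<and> bl y = b) L))"
  proof -
    have "length (filter P L') = (\<Sum>b\<in>bl ` set L. length (filter (\<lambda>y. P y \<and> bl y = b) L'))"
      if "set L' \<subseteq> set L" for L'
      using that
    proof (induction L')
      case (Cons a L')
      have "(\<Sum>b\<in>bl ` set L. length (filter (\<lambda>y. P y \<and> bl y = b) (a # L'))) =
            (\<Sum>b\<in>bl ` set L. (if b = bl a then (if P a then 1 else 0) else 0) + length (filter (\<lambda>y. P y \<and> bl y = b) L'))"
        by (intro sum.cong) auto
      also have "\<dots> = (if P a then 1 else 0) + length (filter P L')"
        using Cons by (simp add: sum.distrib)
      finally show ?case by auto
    qed simp
    then show ?thesis by blast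
  qed
  moreover have "even (length (filter (\<lambda>y. P y \<and> bl y = b) L))" if b: "b \<in> bl ` set L" for b
  proof -
    obtain x where x: "x \<in> set L" "b = bl x" using b by auto
    have Px: "P y \<longleftrightarrow> P x" if "y \<in> set L" "bl y = b" for y
      using P[OF that(1) x(1)] that x by blast
    show ?thesis
    proof (cases "P x")
      case True
      then have "filter (\<lambda>y. P y \<and> bl y = b) L = filter (\<lambda>y. bl y = bl x) L"
        unfolding x(2)[symmetric] using Px by (intro filter_cong) blast+
      then show ?thesis using ev x True by simp
    next
      case False
      then have "filter (\<lambda>y. P y \<and> bl y = b) L = []"
        unfolding filter_empty_conv using Px by blast
      then show ?thesis by simp
    qed
  qed
  ultimately show ?thesis by (simp add: dvd_sum)
qed

text \<open>Block by block: the parity of the number of list entries in a block is read off at any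
  coordinate of \<open>I\<close> in that block once the earlier blocks are known to contribute evenly, and
  the total flip only depends on these parities.\<close>
lemma flips_eq_False_of_block_triangular:
  assumes A: "block_triangular n A bl" and I: "I \<subseteq> {..<n}" "fst ` set L \<subseteq> I"
    and ev: "\<And>i. i \<in> I \<Longrightarrow> \<not> flips A L i" and "j < n"
  shows "\<not> flips A L j"
proof -
  have rows: "tau_row A (fst x) k = tau_row A (fst y) k"
    if "x \<in> set L" "y \<in> set L" "bl (fst x) = bl (fst y)" "k < n" for x y k
  proof -
    have "fst x < n" "fst y < n" using that I by auto
    then show ?thesis using A that unfolding block_triangular_def by blast
  qed
  have cnt: "even (length (filter (\<lambda>k. bl (fst k) = b) L))" for b
  proof (induction b rule: less_induct)
    case (less b)
    show ?case
    proof (cases "\<exists>x\<in>set L. bl (fst x) = b")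
      case False
      then show ?thesis by (simp add: filter_empty_conv)
    next
      case True
      then obtain x where x: "x \<in> set L" "bl (fst x) = b" by blast
      define i where "i = fst x"
      have i: "i \<in> I" "i < n" using x I by (auto simp: i_def)
      \<comment> \<open>Row \<open>fst y\<close> equals row \<open>i\<close>, which has a one at
        \<open>i\<close> because \<open>tau_row\<close> fills the diagonal. So every list entry of
        block \<open>b\<close> flips coordinate \<open>i\<close>, and entries of later blocks do
        not.\<close>
      have same: "tau_row A (fst y) i" if "y \<in> set L" "bl (fst y) = b" for y
        using rows[OF that(1) x(1) _ i(2)] that x by (auto simp: i_def tau_row_def)
      have above: "\<not> tau_row A (fst y) i" if "y \<in> set L" "b < bl (fst y)" for y
      proof -
        have "fst y < n" using that I by auto
        then show ?thesis using A i that x unfolding block_triangular_def tau_row_def i_def by auto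
      qed
      have "even (length (filter (\<lambda>k. tau_row A (fst k) i) L))"
        using ev[OF i(1)] by (simp add: flips_def)
      also have "length (filter (\<lambda>k. tau_row A (fst k) i) L) =
        length (filter (\<lambda>k. bl (fst k) = b) L) + length (filter (\<lambda>k. tau_row A (fst k) i \<and> bl (fst k) < b) L)"
      proof -
        have "length (filter (\<lambda>k. tau_row A (fst k) i) L') =
        length (filter (\<lambda>k. bl (fst k) = b) L') + length (filter (\<lambda>k. tau_row A (fst k) i \<and> bl (fst k) < b) L')"
          if "set L' \<subseteq> set L" for L' using that
        proof (induction L')
          case (Cons y L')
          then show ?case using same[of y] above[of y] by (cases "bl (fst y)" b rule: linorder_cases) auto
        qed simp
        then show ?thesis by blast
      qed
      finally have "even (length (filter (\<lambda>k. bl (fst k) = b) L) + length (filter (\<lambda>k. tau_row A (fst k) i \<and> bl (fst k) < b) L))" .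
      moreover have "even (length (filter (\<lambda>k. tau_row A (fst k) i \<and> bl (fst k) < b) L))"
      proof (rule even_length_filter_of_classes[where bl = "\<lambda>k. bl (fst k)"])
        fix x y assume "x \<in> set L" "y \<in> set L" "bl (fst x) = bl (fst y)"
        then show "(tau_row A (fst x) i \<and> bl (fst x) < b) = (tau_row A (fst y) i \<and> bl (fst y) < b)"
          using rows[of x y i] i by simp
      qed (use less.IH in blast)
      ultimately show ?thesis by simp
    qed
  qed
  have "even (length (filter (\<lambda>k. tau_row A (fst k) j) L))"
    by (rule even_length_filter_of_classes[where bl = "\<lambda>k. bl (fst k)"]) (use rows \<open>j < n\<close> cnt in blast)+
  then show ?thesis by (simp add: flips_def)
qed

lemma flips_append: "flips A (ks @ ls) i \<longleftrightarrow> flips A ks i \<noteq> flips A ls i"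
  by (simp add: flips_def)

text \<open>Ending on the same face means flipping the coordinates in \<open>I\<close> alike; the
  block structure then forces the two compositions to flip all other coordinates alike too.\<close>

lemma strong_pairing_of_block_triangular:
  assumes "block_triangular n A bl"
  shows "strong_pairing n A"
  unfolding strong_pairing_def
proof (intro allI impI)
  fix f ks1 ks2
  assume H: "proper_face n f \<and> valid_comp n A f ks1 \<and> valid_comp n A f ks2 \<and>
        tau_comp A ks1 ` f = tau_comp A ks2 ` f"
  then obtain I e where I: "I \<subseteq> {..<n}" and f: "f = cface n I e"
    unfolding proper_face_def cface_def by blast
  have agree: "flips A ks1 i = flips A ks2 i" if "i \<in> I" for i
    using H cface_eqD[OF I _ that] unfolding f tau_comp_eq_flip flip_image_cface by blast
  have all: "flips A ks1 i = flips A ks2 i" if "i < n" for i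
  proof -
    \<comment> \<open>The concatenation serves as the difference of the two parities. It need not be
      a valid composition; only its indices have to lie in \<open>I\<close>.\<close>
    have "\<not> flips A (ks1 @ ks2) i"
    proof (rule flips_eq_False_of_block_triangular[OF assms I _ _ that])
      show "fst ` set (ks1 @ ks2) \<subseteq> I"
        using H valid_comp_cface[OF I, of A e ks1] valid_comp_cface[OF I, of A e ks2] unfolding f by (simp add: image_Un)
    qed (use agree flips_append in auto)
    then show ?thesis using flips_append by auto
  qed
  show "(\<forall>x\<in>f. tau_comp A ks1 x = tau_comp A ks2 x) \<and>
        (\<forall>F\<in>Xi n f. Psi_comp n A ks1 F = Psi_comp n A ks2 F)"
  proof (intro conjI ballI)
    fix x assume "x \<in> f"
    \<comment> \<open>Points of the cube vanish from coordinate \<open>n\<close> on, so the signs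
      there, about which \<open>block_triangular\<close> says nothing, have no effect.\<close>
    then have "x i = 0" if "i \<ge> n" for i using that by (auto simp: f cface_def cube_def)
    then show "tau_comp A ks1 x = tau_comp A ks2 x"
      unfolding tau_comp_eq_flip flip_def using all by (metis linorder_not_less neg_equal_0_iff_equal)
  next
    fix F assume F: "F \<in> Xi n f"
    then have i: "fst F \<in> I" "e (fst F) = snd F"
      using cface_subset_facet_iff[OF I, of e "fst F" "snd F"] by (auto simp: Xi_def f)
    show "Psi_comp n A ks1 F = Psi_comp n A ks2 F"
      using Psi_comp_eq[OF I _ i(1), of A e] H agree[OF i(1)] unfolding f i(2) by simp
  qed
qed

section \<open>Scaling on the sphere\<close>

lemma unit_sphere_nonzero:
  assumes "v \<in> unit_sphere k"
  obtains i where "i < k" "v i \<noteq> 0"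
proof -
  have "\<exists>i<k. v i \<noteq> 0"
  proof (rule ccontr)
    assume "\<not> ?thesis"
    then have "(\<Sum>i<k. (v i)\<^sup>2) = 0" by (intro sum.neutral) auto
    then show False using assms by (simp add: unit_sphere_def)
  qed
  then show ?thesis using that by blast
qed

lemma sum_squares_pos:
  fixes w :: "nat \<Rightarrow> real"
  assumes "i < k" "w i \<noteq> 0"
  shows "(\<Sum>i<k. (w i)\<^sup>2) > 0"
  using assms by (intro sum_pos2[where i = i]) auto

lemma normalize_vec_in_unit_sphere:
  assumes "\<And>i. i \<ge> k \<Longrightarrow> w i = 0" "i < k" "w i \<noteq> 0"
  shows "normalize_vec k w \<in> unit_sphere k"
proof -
  have "(\<Sum>j<k. (w j / sqrt (\<Sum>i<k. (w i)\<^sup>2))\<^sup>2) = (\<Sum>j<k. (w j)\<^sup>2) / (\<Sum>i<k. (w i)\<^sup>2)"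
    using sum_squares_pos[of i k w] assms(2,3) by (simp add: power_divide flip: sum_divide_distrib)
  then show ?thesis
    using sum_squares_pos[of i k w] assms(2,3) assms(1) by (simp add: normalize_vec_def unit_sphere_def)
qed

lemma normalize_vec_unit: "v \<in> unit_sphere k \<Longrightarrow> normalize_vec k v = v"
  by (simp add: normalize_vec_def unit_sphere_def)

lemma normalize_vec_pos_scale:
  assumes "a > 0"
  shows "normalize_vec k (\<lambda>j. a * v j) = normalize_vec k v"
proof -
  have "(\<Sum>i<k. (a * v i)\<^sup>2) = a\<^sup>2 * (\<Sum>i<k. (v i)\<^sup>2)"
    by (simp add: power_mult_distrib sum_distrib_left)
  then have "sqrt (\<Sum>i<k. (a * v i)\<^sup>2) = a * sqrt (\<Sum>i<k. (v i)\<^sup>2)"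
    using assms by (simp add: real_sqrt_mult)
  then show ?thesis using assms by (simp add: normalize_vec_def)
qed

lemma normalize_vec_mult_normalize_vec:
  assumes "i < k" "w i \<noteq> 0"
  shows "normalize_vec k (\<lambda>j. c j * normalize_vec k w j) = normalize_vec k (\<lambda>j. c j * w j)"
proof -
  let ?a = "inverse (sqrt (\<Sum>i<k. (w i)\<^sup>2))"
  have "(\<lambda>j. c j * normalize_vec k w j) = (\<lambda>j. ?a * (c j * w j))"
    by (simp add: normalize_vec_def divide_inverse mult_ac)
  moreover have "?a > 0" using sum_squares_pos[of i k w] assms by simp
  ultimately show ?thesis using normalize_vec_pos_scale by simp
qed

lemma normalize_vec_flip: "normalize_vec k (flip s w) = flip s (normalize_vec k w)"
proof -
  have "(\<Sum>i<k. (flip s w i)\<^sup>2) = (\<Sum>i<k. (w i)\<^sup>2)"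
    by (intro sum.cong) (auto simp: flip_def)
  then show ?thesis by (auto simp: normalize_vec_def flip_def)
qed

lemma normalize_vec_uminus: "normalize_vec k (\<lambda>i. - w i) = (\<lambda>i. - normalize_vec k w i)"
  using normalize_vec_flip[of k "\<lambda>_. True" w] by (simp add: flip_def)

lemma normalize_vec_scale_in_unit_sphere:
  assumes "v \<in> unit_sphere k" "\<And>j. j < k \<Longrightarrow> r j \<noteq> 0"
  shows "normalize_vec k (\<lambda>j. r j * v j) \<in> unit_sphere k"
proof -
  obtain i where "i < k" "v i \<noteq> 0" using unit_sphere_nonzero assms(1) by blast
  then show ?thesis using assms
    by (intro normalize_vec_in_unit_sphere[where i = i]) (auto simp: unit_sphere_def)
qed

lemma normalize_vec_scale_inverse:
  assumes "v \<in> unit_sphere k" "\<And>j. j < k \<Longrightarrow> r j \<noteq> 0"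
  shows "normalize_vec k (\<lambda>j. inverse (r j) * normalize_vec k (\<lambda>j. r j * v j) j) = v"
proof -
  obtain i where i: "i < k" "v i \<noteq> 0" using unit_sphere_nonzero assms(1) by blast
  have "inverse (r j) * (r j * v j) = v j" for j
    using assms by (cases "j < k") (auto simp: unit_sphere_def)
  then have "(\<lambda>j. inverse (r j) * (r j * v j)) = v" by blast
  then have "normalize_vec k (\<lambda>j. inverse (r j) * (r j * v j)) = v"
    using normalize_vec_unit[OF assms(1)] by simp
  then show ?thesis
    using normalize_vec_mult_normalize_vec[of i k "\<lambda>j. r j * v j" "\<lambda>j. inverse (r j)"] i assms(2) by simp
qed

lemma flip_in_unit_sphere: "v \<in> unit_sphere k \<Longrightarrow> flip s v \<in> unit_sphere k"
proof -
  assume v: "v \<in> unit_sphere k"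
  have "(\<Sum>i<k. (flip s v i)\<^sup>2) = (\<Sum>i<k. (v i)\<^sup>2)"
    by (intro sum.cong) (auto simp: flip_def)
  then show ?thesis using v by (auto simp: unit_sphere_def flip_apply)
qed

lemma uminus_in_unit_sphere: "v \<in> unit_sphere k \<Longrightarrow> (\<lambda>i. - v i) \<in> unit_sphere k"
  by (simp add: unit_sphere_def)

lemma continuous_map_into_fun:
  "continuous_map X (top_of_set S) (f :: 'a \<Rightarrow> 'b \<Rightarrow> 'c::topological_space) \<longleftrightarrow>
     (\<forall>i. continuous_map X euclidean (\<lambda>x. f x i)) \<and> f ` topspace X \<subseteq> S"
  by (simp add: continuous_map_in_subtopology image_subset_iff_funcset
      continuous_map_componentwise_UNIV flip: euclidean_product_topology)

lemma continuous_map_coord: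
  "continuous_map (top_of_set S) euclidean (\<lambda>x. x i :: 'c::topological_space)"
  unfolding continuous_map_iff_continuous
  by (rule continuous_on_subset[OF continuous_on_product_coordinates subset_UNIV])

lemma continuous_map_snd_coord:
  "continuous_map (prod_topology X (top_of_set S)) euclidean (\<lambda>x. snd x i :: 'c::topological_space)"
  using continuous_map_compose[OF continuous_map_snd continuous_map_coord[of S i]]
  by (simp add: o_def)

lemma continuous_map_snd_flip:
  "continuous_map (prod_topology X (top_of_set (unit_sphere k))) (top_of_set (unit_sphere k)) (\<lambda>z. flip s (snd z))"
  unfolding continuous_map_into_fun
  by (auto simp: flip_in_unit_sphere flip_apply intro: continuous_map_snd_coord continuous_map_minus)

lemma continuous_map_normalize_vec:
  assumes "\<And>j. j < k \<Longrightarrow> continuous_map X euclideanreal (\<lambda>z. w z j)"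
    and "\<And>j z. j \<ge> k \<Longrightarrow> z \<in> topspace X \<Longrightarrow> w z j = 0"
    and "\<And>z. z \<in> topspace X \<Longrightarrow> \<exists>j<k. w z j \<noteq> 0"
  shows "continuous_map X (top_of_set (unit_sphere k)) (\<lambda>z. normalize_vec k (w z))"
  unfolding continuous_map_into_fun
proof (intro conjI allI)
  show "(\<lambda>z. normalize_vec k (w z)) ` topspace X \<subseteq> unit_sphere k"
  proof (rule image_subsetI)
    fix z assume z: "z \<in> topspace X"
    then obtain j where "j < k" "w z j \<noteq> 0" using assms(3) by blast
    then show "normalize_vec k (w z) \<in> unit_sphere k"
      using assms(2) z by (intro normalize_vec_in_unit_sphere)
  qed
  fix j
  show "continuous_map X euclideanreal (\<lambda>z. normalize_vec k (w z) j)"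
  proof (cases "j < k")
    case True
    have "sqrt (\<Sum>i<k. (w z i)\<^sup>2) \<noteq> 0" if "z \<in> topspace X" for z
    proof -
      obtain j where "j < k" "w z j \<noteq> 0" using assms(3) \<open>z \<in> topspace X\<close> by blast
      then show ?thesis using sum_squares_pos[of j k "w z"] by simp
    qed
    then show ?thesis unfolding normalize_vec_def using assms(1) True
      by (intro continuous_map_real_divide continuous_map_sqrt continuous_map_sum continuous_map_real_pow) auto
  next
    case False
    show ?thesis
      by (rule continuous_map_eq[of X _ "\<lambda>z. 0"])
        (use False assms(2) in \<open>auto simp: normalize_vec_def\<close>)
  qed
qed

section \<open>Hausdorffness of projectivized bundles\<close>

lemma proj_whitney_bundleE:
  assumes "proj_whitney_bundle M B k p"
  obtains \<U> h g where
    "k \<ge> 1" "continuous_map M B p" "p ` topspace M = topspace B"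
    "\<And>U. U \<in> \<U> \<Longrightarrow> openin B U" "\<Union>\<U> = topspace B"
    "\<And>U. U \<in> \<U> \<Longrightarrow> quotient_map (prod_topology (subtopology B U) (top_of_set (unit_sphere k)))
        (subtopology M {x \<in> topspace M. p x \<in> U}) (h U)"
    "\<And>U b v. \<lbrakk>U \<in> \<U>; b \<in> U; v \<in> unit_sphere k\<rbrakk> \<Longrightarrow> p (h U (b, v)) = b"
    "\<And>U b v w. \<lbrakk>U \<in> \<U>; b \<in> U; v \<in> unit_sphere k; w \<in> unit_sphere k\<rbrakk> \<Longrightarrow>
        h U (b, v) = h U (b, w) \<longleftrightarrow> w = v \<or> w = (\<lambda>j. - v j)"
    "\<And>U V j. \<lbrakk>U \<in> \<U>; V \<in> \<U>; j < k\<rbrakk> \<Longrightarrow>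
        continuous_map (subtopology B (U \<inter> V)) euclideanreal (\<lambda>b. g U V b j)"
    "\<And>U V j b. \<lbrakk>U \<in> \<U>; V \<in> \<U>; j < k; b \<in> U; b \<in> V\<rbrakk> \<Longrightarrow> g U V b j \<noteq> 0"
    "\<And>U V W j b. \<lbrakk>U \<in> \<U>; V \<in> \<U>; W \<in> \<U>; j < k; b \<in> U; b \<in> V; b \<in> W\<rbrakk> \<Longrightarrow>
        g U V b j * g V W b j = g U W b j"
    "\<And>U V b v. \<lbrakk>U \<in> \<U>; V \<in> \<U>; b \<in> U; b \<in> V; v \<in> unit_sphere k\<rbrakk> \<Longrightarrow>
        h V (b, v) = h U (b, normalize_vec k (\<lambda>j. g U V b j * v j))"
  using assms unfolding proj_whitney_bundle_def
proof (elim conjE exE, goal_cases)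
  case H: (1 \<U> h g)
  show ?case
  proof (rule H(1)[of \<U> h g])
    fix U b v w
    assume "U \<in> \<U>" "b \<in> U" "v \<in> unit_sphere k" "w \<in> unit_sphere k"
    then show "h U (b, v) = h U (b, w) \<longleftrightarrow> w = v \<or> w = (\<lambda>j. - v j)"
      using bspec[OF H(7) \<open>U \<in> \<U>\<close>] by (elim conjE) (drule (1) bspec)+
  next
    fix U V b v
    assume "U \<in> \<U>" "V \<in> \<U>" "b \<in> U" "b \<in> V" "v \<in> unit_sphere k"
    then show "h V (b, v) = h U (b, normalize_vec k (\<lambda>j. g U V b j * v j))"
      using H(11) IntI by metis
  next
    fix U V j b
    assume "U \<in> \<U>" "V \<in> \<U>" "j < k" "b \<in> U" "b \<in> V"
    then show "g U V b j \<noteq> 0" using H(8) by blast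
  next
    fix U V W j b
    assume "U \<in> \<U>" "V \<in> \<U>" "W \<in> \<U>" "j < k" "b \<in> U" "b \<in> V" "b \<in> W"
    then show "g U V b j * g V W b j = g U W b j" using H(9) by blast
  next
    fix U b v
    assume "U \<in> \<U>" "b \<in> U" "v \<in> unit_sphere k"
    then show "p (h U (b, v)) = b"
      using bspec[OF H(7) \<open>U \<in> \<U>\<close>] by (elim conjE) (drule (1) bspec)+
  next
    fix U V j
    assume "U \<in> \<U>" "V \<in> \<U>" "j < k"
    then show "continuous_map (subtopology B (U \<inter> V)) euclideanreal (\<lambda>b. g U V b j)"
      using H(8) by blast
  next
    fix U
    assume "U \<in> \<U>"
    then show "openin B U" using H(5) by blast
    show "quotient_map (prod_topology (subtopology B U) (top_of_set (unit_sphere k)))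
        (subtopology M {x \<in> topspace M. p x \<in> U}) (h U)"
      using bspec[OF H(7) \<open>U \<in> \<U>\<close>] by (elim conjE)
  qed (rule H(2-6))+
qed

text \<open>Points over different base points are separated by \<open>p\<close>. Within one fibre
  the products \<open>v i * v j\<close> are even functions that together determine \<open>v\<close>
  up to sign, so one of them descends along the local quotient map and separates the two
  points.\<close>

lemma Hausdorff_space_proj_whitney_bundle:
  assumes pw: "proj_whitney_bundle M B k p" and "Hausdorff_space B"
  shows "Hausdorff_space M"
  unfolding Hausdorff_space_def
proof (intro allI impI)
  fix y y' assume yy: "y \<in> topspace M \<and> y' \<in> topspace M \<and> y \<noteq> y'"
  have p: "continuous_map M B p" and "k \<ge> 1" using pw by (auto simp: proj_whitney_bundle_def)
  show "\<exists>U V. openin M U \<and> openin M V \<and> y \<in> U \<and> y' \<in> V \<and> disjnt U V"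
  proof (cases "p y = p y'")
    case False
    have "p y \<in> topspace B" "p y' \<in> topspace B"
      using p yy by (auto simp: continuous_map_def)
    then obtain U V where UV: "openin B U" "openin B V" "p y \<in> U" "p y' \<in> V" "disjnt U V"
      using \<open>Hausdorff_space B\<close> False by (metis Hausdorff_space_def)
    then show ?thesis using yy openin_continuous_map_preimage[OF p UV(1)] openin_continuous_map_preimage[OF p UV(2)]
      by (intro exI[of _ "{x \<in> topspace M. p x \<in> U}"] exI[of _ "{x \<in> topspace M. p x \<in> V}"]) (auto simp: disjnt_def)
  next
    case True
    obtain \<U> h where cov: "\<And>U. U \<in> \<U> \<Longrightarrow> openin B U" "\<Union>\<U> = topspace B"
      and hq: "\<And>U. U \<in> \<U> \<Longrightarrow> quotient_map (prod_topology (subtopology B U) (top_of_set (unit_sphere k)))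
        (subtopology M {x \<in> topspace M. p x \<in> U}) (h U)"
      and hp: "\<And>U b v. \<lbrakk>U \<in> \<U>; b \<in> U; v \<in> unit_sphere k\<rbrakk> \<Longrightarrow> p (h U (b, v)) = b"
      and hinj: "\<And>U b v w. \<lbrakk>U \<in> \<U>; b \<in> U; v \<in> unit_sphere k; w \<in> unit_sphere k\<rbrakk> \<Longrightarrow>
        h U (b, v) = h U (b, w) \<longleftrightarrow> w = v \<or> w = (\<lambda>j. - v j)"
      by (rule proj_whitney_bundleE[OF pw]) (rule that)
    have "p y \<in> topspace B" using p yy by (auto simp: continuous_map_def)
    then obtain U where U: "U \<in> \<U>" "p y \<in> U" using cov by auto
    let ?P = "prod_topology (subtopology B U) (top_of_set (unit_sphere k))"
    let ?M = "subtopology M {x \<in> topspace M. p x \<in> U}"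
    have q: "quotient_map ?P ?M (h U)" using hq U by blast
    have inj: "w = v \<or> w = (\<lambda>j. - v j)"
      if "(a, v) \<in> topspace ?P" "(b, w) \<in> topspace ?P" "h U (a, v) = h U (b, w)" for a b v w
    proof -
      have *: "a \<in> U" "b \<in> U" "v \<in> unit_sphere k" "w \<in> unit_sphere k" using that by auto
      then have "a = b" using hp[OF U(1)] that(3) by metis
      then show ?thesis using hinj[OF U(1) *(1,3,4)] that(3) by simp
    qed
    have surj: "h U ` topspace ?P = topspace ?M" using quotient_imp_surjective_map[OF q] .
    have "y \<in> topspace ?M" "y' \<in> topspace ?M" using yy U True by auto
    then have "y \<in> h U ` topspace ?P" "y' \<in> h U ` topspace ?P" unfolding surj .
    then obtain a v b w where av: "(a, v) \<in> topspace ?P" "y = h U (a, v)"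
      and bw: "(b, w) \<in> topspace ?P" "y' = h U (b, w)"
      by (elim imageE) (metis surj_pair)
    have *: "a \<in> U" "b \<in> U" "v \<in> unit_sphere k" "w \<in> unit_sphere k" using av bw by auto
    have ab: "a = p y" "b = p y'" 
      using hp[OF U(1) *(1,3)] hp[OF U(1) *(2,4)] by (simp_all add: av(2) bw(2))
    have ne: "w \<noteq> v" "w \<noteq> (\<lambda>j. - v j)"
    proof -
      have "a = b" using ab True by simp
      then have "h U (a, v) \<noteq> h U (a, w)" using yy unfolding av(2) bw(2) by simp
      then show "w \<noteq> v" "w \<noteq> (\<lambda>j. - v j)" using hinj[OF U(1) *(1,3,4)] by blast+
    qed
    have "\<exists>i j. v i * v j \<noteq> w i * w j"
    proof (rule ccontr)
      assume "\<not> ?thesis"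
      then have eq: "v i * v j = w i * w j" for i j by blast
      obtain i where i: "v i \<noteq> 0" using unit_sphere_nonzero[OF *(3)] by blast
      have "(v i - w i) * (v i + w i) = 0" using eq[of i i] by (simp add: algebra_simps)
      then consider "w i = v i" | "w i = - v i" by fastforce
      then show False
      proof cases
        case 1
        then have "w j = v j" for j using eq[of i j] i by simp
        then show False using ne by blast
      next
        case 2
        then have "w j = - v j" for j
        proof -
          have "v i * (w j + v j) = 0" using eq[of i j] 2 by (simp add: algebra_simps)
          then show ?thesis using i by simp
        qed
        then show False using ne by blast
      qed
    qed
    then obtain i j where ij: "v i * v j \<noteq> w i * w j" by blast
    have cont: "continuous_map ?P euclideanreal (\<lambda>z. snd z i * snd z j)"
      by (intro continuous_map_real_mult continuous_map_snd_coord)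
    have resp: "snd x i * snd x j = snd z i * snd z j"
      if "x \<in> topspace ?P" "z \<in> topspace ?P" "h U x = h U z" for x z
      using inj[of "fst x" "snd x" "fst z" "snd z"] that by auto
    obtain g where g: "continuous_map ?M euclideanreal g" and
      gh: "\<And>z. z \<in> topspace ?P \<Longrightarrow> g (h U z) = snd z i * snd z j"
    proof (rule quotient_map_lift_exists[OF q cont])
      fix g assume "continuous_map ?M euclideanreal g"
        "\<And>x. x \<in> topspace ?P \<Longrightarrow> g (h U x) = snd x i * snd x j"
      then show thesis by (rule that)
    qed (rule resp; assumption)
    have "g y \<noteq> g y'" using ij gh[OF av(1)] gh[OF bw(1)] av bw by simp
    then obtain S T where ST: "open S" "open T" "g y \<in> S" "g y' \<in> T" "S \<inter> T = {}"
      using hausdorff by metis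
    have op: "openin M {x \<in> topspace M. p x \<in> U}"
      using openin_continuous_map_preimage[OF p] cov U by blast
    have "openin M {x \<in> topspace ?M. g x \<in> S}" "openin M {x \<in> topspace ?M. g x \<in> T}"
      using openin_trans_full[OF openin_continuous_map_preimage[OF g] op] ST by auto
    then show ?thesis using \<open>y \<in> topspace ?M\<close> \<open>y' \<in> topspace ?M\<close> ST
      by (intro exI[of _ "{x \<in> topspace ?M. g x \<in> S}"] exI[of _ "{x \<in> topspace ?M. g x \<in> T}"]) (auto simp: disjnt_def)
  qed
qed

section \<open>Reduction to sign cocycles\<close>

text \<open>Meant for a bump times a transition function: the second factor is meaningful only on
  \<open>S\<close>, while the bump vanishes on an open set covering the rest.\<close>

lemma continuous_map_extend_zero:
  fixes f :: "'a \<Rightarrow> real"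
  assumes "openin X S" "openin X W" "topspace X \<subseteq> S \<union> W"
    and "continuous_map (subtopology X S) euclideanreal f" "\<And>x. x \<in> W \<Longrightarrow> f x = 0"
  shows "continuous_map X euclideanreal f"
proof (rule pasting_lemma[where I = "{True, False}" and T = "\<lambda>b. if b then S else W"
      and f = "\<lambda>b. if b then f else (\<lambda>_. 0)"])
  fix x assume "x \<in> topspace X"
  then consider "x \<in> S" | "x \<in> W" using assms(3) by blast
  then show "\<exists>j. j \<in> {True, False} \<and> x \<in> (if j then S else W) \<and> f x = (if j then f else (\<lambda>_. 0)) x"
  proof cases
    case 1
    then show ?thesis by (intro exI[of _ True]) simp
  next
    case 2
    then show ?thesis using assms(5) by (intro exI[of _ False]) simp
  qed
qed (use assms in auto)

text \<open>A substitute for a partition of unity: positivity somewhere suffices, so the bumps are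
  not normalized. Vanishing on an open \<open>W\<close> that together with \<open>V d\<close> covers
  the space is stronger than vanishing off \<open>V d\<close>; it makes products with functions
  defined only on \<open>V d\<close> continuous.\<close>

lemma compact_Hausdorff_bumps:
  assumes "compact_space X" "Hausdorff_space X"
    and op: "\<And>U. U \<in> \<U> \<Longrightarrow> openin X U" and cov: "\<Union>\<U> = topspace X"
  obtains D and \<psi> :: "'a \<Rightarrow> 'a \<Rightarrow> real" and V where
    "finite D" "\<And>d. d \<in> D \<Longrightarrow> V d \<in> \<U>" "\<And>d x. \<psi> d x \<ge> 0"
    "\<And>d. d \<in> D \<Longrightarrow> continuous_map X euclideanreal (\<psi> d)"
    "\<And>d. d \<in> D \<Longrightarrow> \<exists>W. openin X W \<and> topspace X \<subseteq> V d \<union> W \<and> (\<forall>x\<in>W. \<psi> d x = 0)"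
    "\<And>x. x \<in> topspace X \<Longrightarrow> \<exists>d\<in>D. \<psi> d x > 0"
proof -
  have cr: "completely_regular_space X"
    using assms(1,2) by (simp add: compact_Hausdorff_or_regular_imp_normal_space normal_imp_completely_regular_space)
  have "\<exists>U f. U \<in> \<U> \<and> b \<in> U \<and> continuous_map X euclideanreal f \<and> f b = 0 \<and> (\<forall>x\<in>topspace X - U. f x = 1)"
    if b: "b \<in> topspace X" for b
  proof -
    obtain U where U: "U \<in> \<U>" "b \<in> U" using b cov by blast
    then have "closedin X (topspace X - U)" "b \<in> topspace X - (topspace X - U)" using op b by auto
    then obtain f :: "'a \<Rightarrow> real" where f: "continuous_map X (top_of_set {0..1}) f" "f b = 0"
      "f ` (topspace X - U) \<subseteq> {1}"
      using cr unfolding completely_regular_space_def by blast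
    then have "continuous_map X euclideanreal f" by (simp add: continuous_map_in_subtopology)
    then show ?thesis using U f(2,3) by (intro exI[of _ U] exI[of _ f]) auto
  qed
  then have "\<forall>b\<in>topspace X. \<exists>U. \<exists>f. U \<in> \<U> \<and> b \<in> U \<and> continuous_map X euclideanreal f \<and>
      f b = 0 \<and> (\<forall>x\<in>topspace X - U. f x = 1)"
    by blast
  from bchoice[OF this] obtain V where "\<forall>b\<in>topspace X. \<exists>f. V b \<in> \<U> \<and> b \<in> V b \<and>
      continuous_map X euclideanreal f \<and> f b = 0 \<and> (\<forall>x\<in>topspace X - V b. f x = 1)" ..
  from bchoice[OF this] obtain f where f: "\<forall>b\<in>topspace X. V b \<in> \<U> \<and> b \<in> V b \<and>
      continuous_map X euclideanreal (f b) \<and> f b b = 0 \<and> (\<forall>x\<in>topspace X - V b. f b x = 1)" ..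
  have Vf: "V b \<in> \<U>" "b \<in> V b" "continuous_map X euclideanreal (f b)" "f b b = 0"
    if "b \<in> topspace X" for b
    using bspec[OF f that] by blast+
  have Vf1: "f b x = 1" if "b \<in> topspace X" "x \<in> topspace X" "x \<notin> V b" for b x
    using bspec[OF f that(1)] that by blast
  let ?N = "\<lambda>b. {x \<in> topspace X. f b x \<in> {..<1/2}}"
  have "\<forall>N\<in>?N ` topspace X. openin X N"
  proof (rule ballI, elim imageE)
    fix N b assume "N = ?N b" "b \<in> topspace X"
    then show "openin X N" using openin_continuous_map_preimage[OF Vf(3), of b "{..<1/2}"] by simp
  qed
  moreover have "topspace X \<subseteq> \<Union>(?N ` topspace X)"
  proof
    fix b assume "b \<in> topspace X"
    then have "b \<in> ?N b" using Vf(4)[of b] by simp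
    then show "b \<in> \<Union>(?N ` topspace X)" using \<open>b \<in> topspace X\<close> by blast
  qed
  ultimately obtain F where F: "finite F" "F \<subseteq> ?N ` topspace X" "topspace X \<subseteq> \<Union>F"
    using assms(1) unfolding compact_space_alt by meson
  obtain D where D: "D \<subseteq> topspace X" "finite D" "F = ?N ` D"
    using finite_subset_image[OF F(1,2)] by blast
  \<comment> \<open>The level \<open>1/2\<close> leaves room: the bump is positive where
    \<open>f d\<close> is below it, and the set where \<open>f d\<close> exceeds it is open and
    contains the complement of \<open>V d\<close>, where \<open>f d\<close> is 1.\<close>
  let ?\<psi> = "\<lambda>d x. max 0 (1/2 - f d x)"
  show ?thesis
  proof (rule that[of D V ?\<psi>])
    fix d assume d: "d \<in> D"
    then have dX: "d \<in> topspace X" using D(1) by blast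
    show "V d \<in> \<U>" using Vf(1)[OF dX] .
    show "continuous_map X euclideanreal (?\<psi> d)"
      using Vf(3)[OF dX] by (intro continuous_map_real_max continuous_map_diff) auto
    show "\<exists>W. openin X W \<and> topspace X \<subseteq> V d \<union> W \<and> (\<forall>x\<in>W. ?\<psi> d x = 0)"
    proof (intro exI[of _ "{x \<in> topspace X. f d x \<in> {1/2<..}}"] conjI)
      show "openin X {x \<in> topspace X. f d x \<in> {1/2<..}}"
        using openin_continuous_map_preimage[OF Vf(3)[OF dX], of "{1/2<..}"] by simp
      show "topspace X \<subseteq> V d \<union> {x \<in> topspace X. f d x \<in> {1/2<..}}"
        using Vf1[OF dX] by fastforce
    qed auto
  next
    fix x assume x: "x \<in> topspace X"
    then obtain d where "d \<in> D" "x \<in> ?N d" using F(3) D(3) by blast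
    then show "\<exists>d\<in>D. ?\<psi> d x > 0" by (intro bexI[of _ d]) auto
  qed (use D(2) in auto)
qed

text \<open>A bundle metric has turned the transition functions into signs; \<open>H U\<close> are the local
  presentations of the bundle in orthonormal frames.\<close>
locale sign_bundle =
  fixes M B :: "'a topology" and k :: nat and p :: "'a \<Rightarrow> 'a"
    and \<U> :: "'a set set" and H :: "'a set \<Rightarrow> 'a \<times> (nat \<Rightarrow> real) \<Rightarrow> 'a"
  assumes Hausdorff_M: "Hausdorff_space M" and k_pos: "k \<ge> 1"
    and p_cont: "continuous_map M B p"
    and \<U>_open: "U \<in> \<U> \<Longrightarrow> openin B U" and \<U>_cover: "\<Union>\<U> = topspace B"
    and H_cont: "U \<in> \<U> \<Longrightarrow>
      continuous_map (prod_topology (subtopology B U) (top_of_set (unit_sphere k))) M (H U)"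
    and p_H: "\<lbrakk>U \<in> \<U>; b \<in> U; v \<in> unit_sphere k\<rbrakk> \<Longrightarrow> p (H U (b, v)) = b"
    and H_eq_iff: "\<lbrakk>U \<in> \<U>; b \<in> U; v \<in> unit_sphere k; w \<in> unit_sphere k\<rbrakk> \<Longrightarrow>
      H U (b, v) = H U (b, w) \<longleftrightarrow> w = v \<or> w = (\<lambda>j. - v j)"
    and H_surj: "\<lbrakk>U \<in> \<U>; y \<in> topspace M; p y \<in> U\<rbrakk> \<Longrightarrow> \<exists>v\<in>unit_sphere k. y = H U (p y, v)"
    and H_trans: "\<lbrakk>U \<in> \<U>; V \<in> \<U>; b \<in> U; b \<in> V\<rbrakk> \<Longrightarrow>
      \<exists>s. \<forall>v\<in>unit_sphere k. H V (b, v) = H U (b, flip s v)"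

text \<open>Dividing out a bundle metric leaves only the signs of the transition functions.
  \<open>H U\<close> is \<open>h U\<close> in coordinates with respect to unit vectors of the line
  bundles, and \<open>N U b\<close> is the corresponding bijection of the sphere.\<close>

lemma sign_bundle_of_proj_whitney_bundle:
  assumes pw: "proj_whitney_bundle M B k p" and B: "compact_space B" "Hausdorff_space B"
  obtains \<U> H where "sign_bundle M B k p \<U> H"
proof -
  let ?S = "unit_sphere k"
  obtain \<U> h g where
    "k \<ge> 1" and p: "continuous_map M B p" and "p ` topspace M = topspace B"
    and op: "\<And>U. U \<in> \<U> \<Longrightarrow> openin B U" and cov: "\<Union>\<U> = topspace B"
    and hq: "\<And>U. U \<in> \<U> \<Longrightarrow> quotient_map (prod_topology (subtopology B U) (top_of_set ?S))
        (subtopology M {x \<in> topspace M. p x \<in> U}) (h U)"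
    and ph: "\<And>U b v. \<lbrakk>U \<in> \<U>; b \<in> U; v \<in> ?S\<rbrakk> \<Longrightarrow> p (h U (b, v)) = b"
    and hinj: "\<And>U b v w. \<lbrakk>U \<in> \<U>; b \<in> U; v \<in> ?S; w \<in> ?S\<rbrakk> \<Longrightarrow>
        h U (b, v) = h U (b, w) \<longleftrightarrow> w = v \<or> w = (\<lambda>j. - v j)"
    and gcont: "\<And>U V j. \<lbrakk>U \<in> \<U>; V \<in> \<U>; j < k\<rbrakk> \<Longrightarrow>
        continuous_map (subtopology B (U \<inter> V)) euclideanreal (\<lambda>b. g U V b j)"
    and gnz: "\<And>U V j b. \<lbrakk>U \<in> \<U>; V \<in> \<U>; j < k; b \<in> U; b \<in> V\<rbrakk> \<Longrightarrow> g U V b j \<noteq> 0"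
    and cocycle: "\<And>U V W j b. \<lbrakk>U \<in> \<U>; V \<in> \<U>; W \<in> \<U>; j < k; b \<in> U; b \<in> V; b \<in> W\<rbrakk> \<Longrightarrow>
        g U V b j * g V W b j = g U W b j"
    and htrans: "\<And>U V b v. \<lbrakk>U \<in> \<U>; V \<in> \<U>; b \<in> U; b \<in> V; v \<in> ?S\<rbrakk> \<Longrightarrow>
        h V (b, v) = h U (b, normalize_vec k (\<lambda>j. g U V b j * v j))"
    by (rule proj_whitney_bundleE[OF pw]) (rule that)
  obtain D and \<psi> :: "'a \<Rightarrow> 'a \<Rightarrow> real" and V where
    D: "finite D" and V: "\<And>d. d \<in> D \<Longrightarrow> V d \<in> \<U>" and \<psi>0: "\<And>d x. \<psi> d x \<ge> 0"
    and \<psi>cont: "\<And>d. d \<in> D \<Longrightarrow> continuous_map B euclideanreal (\<psi> d)"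
    and \<psi>W: "\<And>d. d \<in> D \<Longrightarrow> \<exists>W. openin B W \<and> topspace B \<subseteq> V d \<union> W \<and> (\<forall>x\<in>W. \<psi> d x = 0)"
    and \<psi>pos: "\<And>x. x \<in> topspace B \<Longrightarrow> \<exists>d\<in>D. \<psi> d x > 0"
    by (rule compact_Hausdorff_bumps[OF B op cov], assumption) (rule that)
  have \<psi>V: "b \<in> V d" if "d \<in> D" "b \<in> topspace B" "\<psi> d b \<noteq> 0" for d b
    using \<psi>W[OF that(1)] that by blast
  \<comment> \<open>This defines the metric: \<open>r U b j\<close> is, up to sign, the coordinate
    over \<open>U\<close> of a unit vector of the \<open>j\<close>-th line bundle at
    \<open>b\<close>. It is a weighted sum of the absolute coordinates of the local frames over the
    \<open>V d\<close>; a summand with \<open>b\<close> outside \<open>V d\<close> has weight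
    zero.\<close>
  define r where "r U b j = (\<Sum>d\<in>D. \<psi> d b * \<bar>g U (V d) b j\<bar>)" for U b j
  have UB: "b \<in> topspace B" if "U \<in> \<U>" "b \<in> U" for U b using that cov by blast
  have rpos: "r U b j > 0" if "U \<in> \<U>" "b \<in> U" "j < k" for U b j
  proof -
    obtain d where d: "d \<in> D" "\<psi> d b > 0" using \<psi>pos UB \<open>U \<in> \<U>\<close> \<open>b \<in> U\<close> by blast
    then have "b \<in> V d" using \<psi>V UB that by (metis less_irrefl)
    then have "g U (V d) b j \<noteq> 0" using gnz V d that by blast
    then show ?thesis unfolding r_def using D d \<psi>0 by (intro sum_pos2[where i = d]) auto
  qed
  have rcont: "continuous_map (subtopology B U) euclideanreal (\<lambda>b. r U b j)"
    if U: "U \<in> \<U>" and j: "j < k" for U j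
    unfolding r_def
  proof (rule continuous_map_sum[OF D])
    fix d assume d: "d \<in> D"
    obtain W where W: "openin B W" "topspace B \<subseteq> V d \<union> W" "\<forall>x\<in>W. \<psi> d x = 0" using \<psi>W[OF d] by blast
    show "continuous_map (subtopology B U) euclideanreal (\<lambda>b. \<psi> d b * \<bar>g U (V d) b j\<bar>)"
    proof (rule continuous_map_extend_zero[where S = "V d \<inter> U" and W = "W \<inter> U"])
      show "openin (subtopology B U) (V d \<inter> U)" "openin (subtopology B U) (W \<inter> U)"
        using op[OF V[OF d]] W(1) by (auto simp: openin_subtopology)
      show "topspace (subtopology B U) \<subseteq> V d \<inter> U \<union> W \<inter> U" using W(2) by auto
      have "subtopology (subtopology B U) (V d \<inter> U) = subtopology B (U \<inter> V d)"
        by (simp add: subtopology_subtopology) (metis Int_assoc Int_absorb Int_commute)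
      then show "continuous_map (subtopology (subtopology B U) (V d \<inter> U)) euclideanreal
          (\<lambda>b. \<psi> d b * \<bar>g U (V d) b j\<bar>)"
        using gcont[OF U V[OF d] j] continuous_map_from_subtopology[OF \<psi>cont[OF d]]
        by (auto intro!: continuous_map_real_mult continuous_map_real_abs)
      show "\<psi> d b * \<bar>g U (V d) b j\<bar> = 0" if "b \<in> W \<inter> U" for b using W(3) that by simp
    qed
  qed
  \<comment> \<open>By the cocycle identity \<open>r\<close> changes like the absolute value of a
    transition function, so in unit coordinates only the sign of \<open>g\<close> survives.\<close>
  have rtrans: "\<bar>g U U' b j\<bar> * r U' b j = r U b j"
    if U: "U \<in> \<U>" "U' \<in> \<U>" "b \<in> U" "b \<in> U'" and j: "j < k" for U U' b j
    unfolding r_def sum_distrib_left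
  proof (rule sum.cong[OF refl])
    fix d assume d: "d \<in> D"
    show "\<bar>g U U' b j\<bar> * (\<psi> d b * \<bar>g U' (V d) b j\<bar>) = \<psi> d b * \<bar>g U (V d) b j\<bar>"
    proof (cases "\<psi> d b = 0")
      case False
      then have "b \<in> V d" using \<psi>V[OF d UB[OF U(1,3)]] by blast
      then have "\<bar>g U U' b j\<bar> * \<bar>g U' (V d) b j\<bar> = \<bar>g U (V d) b j\<bar>"
        using cocycle[OF U(1,2) V[OF d] j U(3,4)] abs_mult by metis
      then show ?thesis by simp
    qed simp
  qed
  define N where "N U b v = normalize_vec k (\<lambda>j. r U b j * v j)" for U b v
  define H where "H U z = h U (fst z, N U (fst z) (snd z))" for U z
  have rnz: "r U b j \<noteq> 0" if "U \<in> \<U>" "b \<in> U" "j < k" for U b j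
    using rpos[OF that] by simp
  have NS: "N U b v \<in> ?S" if "U \<in> \<U>" "b \<in> U" "v \<in> ?S" for U b v
    unfolding N_def using normalize_vec_scale_in_unit_sphere[OF that(3)] rnz[OF that(1,2)] by blast
  have N_uminus: "N U b (\<lambda>j. - v j) = (\<lambda>j. - N U b v j)" for U b v
    unfolding N_def normalize_vec_uminus[symmetric] by simp
  have N_inj: "v = w" if U: "U \<in> \<U>" "b \<in> U" "v \<in> ?S" "w \<in> ?S" and eq: "N U b v = N U b w" for U b v w
  proof -
    have "normalize_vec k (\<lambda>j. inverse (r U b j) * N U b v j) = v"
      unfolding N_def using normalize_vec_scale_inverse[OF U(3)] rnz[OF U(1,2)] by blast
    moreover have "normalize_vec k (\<lambda>j. inverse (r U b j) * N U b w j) = w"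
      unfolding N_def using normalize_vec_scale_inverse[OF U(4)] rnz[OF U(1,2)] by blast
    ultimately show ?thesis unfolding eq by metis
  qed
  have "sign_bundle M B k p \<U> H"
  proof
    show "Hausdorff_space M" using Hausdorff_space_proj_whitney_bundle[OF pw B(2)] .
    show "k \<ge> 1" "continuous_map M B p" "\<Union>\<U> = topspace B" by fact+
  next
    fix U assume U: "U \<in> \<U>"
    show "openin B U" using op[OF U] .
    let ?P = "prod_topology (subtopology B U) (top_of_set ?S)"
    have "continuous_map ?P (top_of_set ?S) (\<lambda>z. normalize_vec k (\<lambda>j. r U (fst z) j * snd z j))"
    proof (rule continuous_map_normalize_vec)
      show "continuous_map ?P euclideanreal (\<lambda>z. r U (fst z) j * snd z j)" if "j < k" for j
        using continuous_map_compose[OF continuous_map_fst rcont[OF U that]]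
        by (intro continuous_map_real_mult continuous_map_snd_coord) (simp add: o_def)
      show "r U (fst z) j * snd z j = 0" if "j \<ge> k" "z \<in> topspace ?P" for j z
        using that by (auto simp: unit_sphere_def)
      show "\<exists>j<k. r U (fst z) j * snd z j \<noteq> 0" if "z \<in> topspace ?P" for z
      proof -
        have z: "fst z \<in> U" "snd z \<in> ?S" using that by auto
        obtain j where "j < k" "snd z j \<noteq> 0" using unit_sphere_nonzero[OF z(2)] .
        then show ?thesis using rnz[OF U z(1)] by auto
      qed
    qed
    then have "continuous_map ?P ?P (\<lambda>z. (fst z, N U (fst z) (snd z)))"
      unfolding N_def by (intro continuous_map_pairedI continuous_map_fst)
    then have "continuous_map ?P (subtopology M {x \<in> topspace M. p x \<in> U}) (h U \<circ> (\<lambda>z. (fst z, N U (fst z) (snd z))))"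
      using continuous_map_compose quotient_imp_continuous_map[OF hq[OF U]] by blast
    then show "continuous_map ?P M (H U)"
      unfolding H_def o_def by (rule continuous_map_into_fulltopology)
  next
    fix U b v assume U: "U \<in> \<U>" "b \<in> U" "v \<in> ?S"
    show "p (H U (b, v)) = b" unfolding H_def using ph[OF U(1,2) NS[OF U]] by simp
  next
    fix U b v w assume U: "U \<in> \<U>" "b \<in> U" "v \<in> ?S" "w \<in> ?S"
    have "H U (b, v) = H U (b, w) \<longleftrightarrow> N U b w = N U b v \<or> N U b w = (\<lambda>j. - N U b v j)"
      unfolding H_def using hinj[OF U(1,2) NS[OF U(1-3)] NS[OF U(1,2,4)]] by simp
    also have "\<dots> \<longleftrightarrow> w = v \<or> w = (\<lambda>j. - v j)"
      unfolding N_uminus[symmetric]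
      using N_inj[OF U(1,2,4,3)] N_inj[OF U(1,2,4) uminus_in_unit_sphere[OF U(3)]] by blast
    finally show "H U (b, v) = H U (b, w) \<longleftrightarrow> w = v \<or> w = (\<lambda>j. - v j)" .
  next
    fix U y assume U: "U \<in> \<U>" "y \<in> topspace M" "p y \<in> U"
    let ?P = "prod_topology (subtopology B U) (top_of_set ?S)"
    have "y \<in> topspace (subtopology M {x \<in> topspace M. p x \<in> U})" using U by simp
    then have "y \<in> h U ` topspace ?P" unfolding quotient_imp_surjective_map[OF hq[OF U(1)]] .
    then obtain z where z: "y = h U z" "z \<in> topspace ?P" by blast
    obtain b v where zbv: "z = (b, v)" by fastforce
    have bv: "b \<in> U" "v \<in> ?S" "y = h U (b, v)" using z unfolding zbv by auto
    have b: "b = p y" using ph[OF U(1) bv(1,2)] bv(3) by simp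
    let ?w = "normalize_vec k (\<lambda>j. inverse (r U b j) * v j)"
    have w: "?w \<in> ?S" by (intro normalize_vec_scale_in_unit_sphere bv) (use rnz[OF U(1) bv(1)] in auto)
    have "N U b ?w = v"
      unfolding N_def
      using normalize_vec_scale_inverse[OF bv(2), of "\<lambda>j. inverse (r U b j)"] rnz[OF U(1) bv(1)] by simp
    then have "y = H U (p y, ?w)" unfolding b[symmetric] H_def using bv(3) by simp
    then show "\<exists>v\<in>?S. y = H U (p y, v)" using w by blast
  next
    fix U U' b assume U: "U \<in> \<U>" "U' \<in> \<U>" "b \<in> U" "b \<in> U'"
    define s where "s j \<longleftrightarrow> j < k \<and> g U U' b j < 0" for j
    have "H U' (b, v) = H U (b, flip s v)" if v: "v \<in> ?S" for v
    proof -
      obtain i where i: "i < k" "v i \<noteq> 0" using unit_sphere_nonzero[OF v] .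
      have "(\<lambda>j. g U U' b j * (r U' b j * v j)) = (\<lambda>j. r U b j * flip s v j)"
      proof
        fix j
        show "g U U' b j * (r U' b j * v j) = r U b j * flip s v j"
        proof (cases "j < k")
          case True
          then have "r U b j = \<bar>g U U' b j\<bar> * r U' b j" using rtrans[OF U] by simp
          then show ?thesis using True by (simp add: flip_apply s_def)
        next
          case False
          then have "v j = 0" using v by (simp add: unit_sphere_def)
          then show ?thesis by (simp add: flip_apply)
        qed
      qed
      moreover have "normalize_vec k (\<lambda>j. g U U' b j * N U' b v j) =
          normalize_vec k (\<lambda>j. g U U' b j * (r U' b j * v j))"
        unfolding N_def using i rnz[OF U(2,4) i(1)] by (intro normalize_vec_mult_normalize_vec) auto
      ultimately have "normalize_vec k (\<lambda>j. g U U' b j * N U' b v j) = N U b (flip s v)"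
        unfolding N_def by simp
      then show ?thesis unfolding H_def using htrans[OF U NS[OF U(2,4) v]] by simp
    qed
    then show "\<exists>s. \<forall>v\<in>?S. H U' (b, v) = H U (b, flip s v)" by blast
  qed
  then show ?thesis by (rule that)
qed

section \<open>Frames along a map from the cube\<close>

text \<open>None of the \<open>k\<close> coordinates vanishes, so different sign changes of them
  give different vectors, and opposite ones give antipodal vectors.\<close>

definition diagonal_unit :: "nat \<Rightarrow> nat \<Rightarrow> real" where
  "diagonal_unit k = (\<lambda>i. if i < k then 1 / sqrt (real k) else 0)"

lemma diagonal_unit_in_unit_sphere: "k \<ge> 1 \<Longrightarrow> diagonal_unit k \<in> unit_sphere k"
  by (simp add: diagonal_unit_def unit_sphere_def power_divide)

lemma flip_diagonal_unit_eq_iff: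
  assumes "k \<ge> 1"
  shows "flip s (diagonal_unit k) = flip t (diagonal_unit k) \<longleftrightarrow> (\<forall>i<k. s i = t i)"
    and "flip s (diagonal_unit k) = (\<lambda>i. - flip t (diagonal_unit k) i) \<longleftrightarrow> (\<forall>i<k. s i \<noteq> t i)"
  using assms by (auto simp: fun_eq_iff flip_def diagonal_unit_def)

lemma flip_cong_unit_sphere:
  assumes "v \<in> unit_sphere k" "\<And>i. i < k \<Longrightarrow> s i = t i"
  shows "flip s v = flip t v"
proof
  fix i show "flip s v i = flip t v i"
    using assms by (cases "i < k") (auto simp: flip_def unit_sphere_def)
qed

lemma flip_neg_cong_unit_sphere:
  assumes "v \<in> unit_sphere k" "\<And>i. i < k \<Longrightarrow> s i \<noteq> t i"
  shows "flip s v = (\<lambda>i. - flip t v i)"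
proof
  fix i show "flip s v i = - flip t v i"
    using assms by (cases "i < k") (auto simp: flip_def unit_sphere_def)
qed

lemma flip_eq_flip_iff: "flip s v = flip s w \<longleftrightarrow> v = w"
  by (metis flip_flip_self)

lemma connected_coordinatewise:
  fixes J :: "nat \<Rightarrow> real set"
  assumes "\<And>i. connected (J i)"
  shows "connected {x. \<forall>i. x i \<in> J i}"
proof -
  have "connectedin (product_topology (\<lambda>_. euclidean) UNIV) (PiE UNIV J)"
    unfolding connectedin_PiE using assms by auto
  moreover have "PiE UNIV J = {x. \<forall>i. x i \<in> J i}" by (simp add: PiE_UNIV_domain Pi_def)
  ultimately show ?thesis by (simp add: euclidean_product_topology)
qed

lemma cube_alt: "cube n = {x. \<forall>i. x i \<in> (if i < n then {- 1/4..1/4} else {0})}" (is "_ = ?R")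
proof (intro set_eqI iffI)
  fix x assume "x \<in> cube n"
  then have "x i \<in> (if i < n then {- 1/4..1/4} else {0})" for i
    by (cases "i < n") (simp_all add: cube_def)
  then show "x \<in> ?R" by blast
next
  fix x assume "x \<in> ?R"
  then have x: "x i \<in> (if i < n then {- 1/4..1/4} else {0})" for i by blast
  have "- 1/4 \<le> x i \<and> x i \<le> 1/4" if "i < n" for i using x[of i] that by simp
  moreover have "x i = 0" if "i \<ge> n" for i using x[of i] that by simp
  ultimately show "x \<in> cube n" unfolding cube_def by blast
qed

lemma compact_cube: "compact (cube n)"
proof -
  let ?J = "\<lambda>i. if i < n then {- 1/4..1/4} else {0 :: real}"
  have "compactin (product_topology (\<lambda>_. euclidean) UNIV) (PiE UNIV ?J)"
    unfolding compactin_PiE by simp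
  moreover have "PiE UNIV ?J = cube n" unfolding cube_alt by (simp add: PiE_UNIV_domain Pi_def)
  ultimately show ?thesis by (simp add: euclidean_product_topology)
qed

lemma connected_facet:
  assumes "fst j < n"
  shows "connected (facet n j)"
proof -
  define c where "c = (if snd j then 1/4 else - 1/4 :: real)"
  let ?J = "\<lambda>i. if i = fst j then {c} else if i < n then {- 1/4..1/4} else {0}"
  have "x \<in> facet n j \<longleftrightarrow> (\<forall>i. x i \<in> ?J i)" for x
  proof
    assume "x \<in> facet n j"
    then have c: "x (fst j) = c" and cube: "\<forall>i. x i \<in> (if i < n then {- 1/4..1/4} else {0})"
      unfolding facet_def c_def cube_alt by simp_all
    have "x i \<in> ?J i" for i
    proof (cases "i = fst j")
      case True
      then show ?thesis using c by simp
    next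
      case False
      then show ?thesis using spec[OF cube, of i] by simp
    qed
    then show "\<forall>i. x i \<in> ?J i" by blast
  next
    assume J: "\<forall>i. x i \<in> ?J i"
    then have c: "x (fst j) = c" using spec[OF J, of "fst j"] by simp
    have "x i \<in> (if i < n then {- 1/4..1/4} else {0})" for i
    proof (cases "i = fst j")
      case True
      then show ?thesis using c assms by (simp add: c_def)
    next
      case False
      then show ?thesis using spec[OF J, of i] by simp
    qed
    then show "x \<in> facet n j" using c unfolding facet_def cube_alt c_def by simp
  qed
  then have "facet n j = {x. \<forall>i. x i \<in> ?J i}" by blast
  then show ?thesis by (simp only:) (rule connected_coordinatewise, simp)
qed

section \<open>Orthonormal frames of a single fibre\<close>

context sign_bundle
begin

text \<open>Only the values of \<open>\<phi>\<close> on the sphere count. The choice of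
  \<open>U\<close> is immaterial, since by \<open>H_trans\<close> another one merely changes
  \<open>s\<close>.\<close>

definition frame :: "'a \<Rightarrow> ((nat \<Rightarrow> real) \<Rightarrow> 'a) \<Rightarrow> bool" where
  "frame b \<phi> \<longleftrightarrow> (\<exists>U\<in>\<U>. b \<in> U \<and> (\<exists>s. \<forall>v\<in>unit_sphere k. \<phi> v = H U (b, flip s v)))"

lemma frameE:
  assumes "frame b \<phi>"
  obtains U s where "U \<in> \<U>" "b \<in> U" "\<And>v. v \<in> unit_sphere k \<Longrightarrow> \<phi> v = H U (b, flip s v)"
  using assms unfolding frame_def by blast

lemma frame_local: "\<lbrakk>U \<in> \<U>; b \<in> U\<rbrakk> \<Longrightarrow> frame b (\<lambda>v. H U (b, v))"
  unfolding frame_def by (intro bexI[of _ U] conjI exI[of _ "\<lambda>_. False"]) auto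

lemma frame_flip:
  assumes "frame b \<phi>"
  shows "frame b (\<lambda>v. \<phi> (flip t v))"
proof -
  obtain U s where U: "U \<in> \<U>" "b \<in> U" "\<And>v. v \<in> unit_sphere k \<Longrightarrow> \<phi> v = H U (b, flip s v)"
    by (rule frameE[OF assms]) (rule that)
  have "\<phi> (flip t v) = H U (b, flip (\<lambda>i. s i \<noteq> t i) v)" if "v \<in> unit_sphere k" for v
    using U(3)[OF flip_in_unit_sphere[OF that]] by (simp add: flip_flip)
  then show ?thesis unfolding frame_def using U by blast
qed

lemma frame_related:
  assumes "frame b \<phi>" "frame b \<psi>"
  obtains s where "\<And>v. v \<in> unit_sphere k \<Longrightarrow> \<psi> v = \<phi> (flip s v)"
proof -
  obtain U s where U: "U \<in> \<U>" "b \<in> U" "\<And>v. v \<in> unit_sphere k \<Longrightarrow> \<phi> v = H U (b, flip s v)"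
    by (rule frameE[OF assms(1)]) (rule that)
  obtain V t where V: "V \<in> \<U>" "b \<in> V" "\<And>v. v \<in> unit_sphere k \<Longrightarrow> \<psi> v = H V (b, flip t v)"
    by (rule frameE[OF assms(2)]) (rule that)
  obtain u where u: "\<forall>v\<in>unit_sphere k. H V (b, v) = H U (b, flip u v)"
    using H_trans[OF U(1) V(1) U(2) V(2)] by blast
  show ?thesis
  proof (rule that)
    fix v assume v: "v \<in> unit_sphere k"
    have "\<psi> v = H U (b, flip u (flip t v))" using V(3)[OF v] u flip_in_unit_sphere[OF v] by simp
    also have "flip u (flip t v) = flip s (flip (\<lambda>i. s i \<noteq> (u i \<noteq> t i)) v)"
      by (auto simp: flip_def)
    also have "H U (b, \<dots>) = \<phi> (flip (\<lambda>i. s i \<noteq> (u i \<noteq> t i)) v)"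
      using U(3)[OF flip_in_unit_sphere[OF v]] by simp
    finally show "\<psi> v = \<phi> (flip (\<lambda>i. s i \<noteq> (u i \<noteq> t i)) v)" .
  qed
qed

lemma frame_eq_iff:
  assumes "frame b \<phi>" "v \<in> unit_sphere k" "w \<in> unit_sphere k"
  shows "\<phi> v = \<phi> w \<longleftrightarrow> w = v \<or> w = (\<lambda>i. - v i)"
proof -
  obtain U s where U: "U \<in> \<U>" "b \<in> U" "\<And>v. v \<in> unit_sphere k \<Longrightarrow> \<phi> v = H U (b, flip s v)"
    by (rule frameE[OF assms(1)]) (rule that)
  have "\<phi> v = \<phi> w \<longleftrightarrow> flip s w = flip s v \<or> flip s w = (\<lambda>i. - flip s v i)"
    using H_eq_iff[OF U(1,2) flip_in_unit_sphere flip_in_unit_sphere] assms(2,3) U(3) by simp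
  then show ?thesis unfolding flip_uminus[symmetric] flip_eq_flip_iff .
qed

lemma frame_p: "\<lbrakk>frame b \<phi>; v \<in> unit_sphere k\<rbrakk> \<Longrightarrow> p (\<phi> v) = b"
  by (elim frameE) (simp add: p_H flip_in_unit_sphere)

lemma frame_surj:
  assumes "frame b \<phi>" "y \<in> topspace M" "p y = b"
  shows "\<exists>v\<in>unit_sphere k. \<phi> v = y"
proof -
  obtain U s where U: "U \<in> \<U>" "b \<in> U" "\<And>v. v \<in> unit_sphere k \<Longrightarrow> \<phi> v = H U (b, flip s v)"
    by (rule frameE[OF assms(1)]) (rule that)
  obtain w where w: "w \<in> unit_sphere k" "y = H U (b, w)"
    using H_surj[OF U(1) assms(2)] U(2) assms(3) by auto
  then have "\<phi> (flip s w) = y" using U(3)[OF flip_in_unit_sphere[OF w(1)]] by simp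
  then show ?thesis using flip_in_unit_sphere[OF w(1)] by blast
qed

lemma diagonal_in: "diagonal_unit k \<in> unit_sphere k"
  using diagonal_unit_in_unit_sphere k_pos by simp

lemma frame_diagonal_eq_iff:
  assumes "frame b \<phi>"
  shows "\<phi> (flip s (diagonal_unit k)) = \<phi> (flip t (diagonal_unit k)) \<longleftrightarrow>
    (\<forall>i<k. s i = t i) \<or> (\<forall>i<k. s i \<noteq> t i)"
proof -
  have "\<phi> (flip s (diagonal_unit k)) = \<phi> (flip t (diagonal_unit k)) \<longleftrightarrow>
    (\<forall>i<k. t i = s i) \<or> (\<forall>i<k. t i \<noteq> s i)"
    unfolding frame_eq_iff[OF assms flip_in_unit_sphere[OF diagonal_in] flip_in_unit_sphere[OF diagonal_in]]
      flip_diagonal_unit_eq_iff[OF k_pos] ..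
  then show ?thesis by metis
qed

text \<open>The generic vector \<open>diagonal_unit k\<close> detects the sign change between two frames.\<close>
lemma frame_diagonal_determined:
  assumes "frame b \<phi>" "\<phi> (flip s (diagonal_unit k)) = \<phi> (flip t (diagonal_unit k))" "v \<in> unit_sphere k"
  shows "\<phi> (flip s v) = \<phi> (flip t v)"
proof -
  consider "\<forall>i<k. s i = t i" | "\<forall>i<k. s i \<noteq> t i"
    using iffD1[OF frame_diagonal_eq_iff[OF assms(1)] assms(2)] by blast
  then show ?thesis
  proof cases
    case 1
    then show ?thesis using flip_cong_unit_sphere[OF assms(3), of s t] by simp
  next
    case 2
    then have "flip s v = (\<lambda>i. - flip t v i)" using flip_neg_cong_unit_sphere[OF assms(3), of s t] by simp
    then show ?thesis
      using frame_eq_iff[OF assms(1) flip_in_unit_sphere[OF assms(3), of t] flip_in_unit_sphere[OF assms(3), of s]]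
      by simp
  qed
qed

text \<open>Frames of the pullback of the bundle along \<open>q\<close>, written with values in
  \<open>M\<close> itself so that no pullback has to be formed.\<close>

definition frame_field :: "((nat \<Rightarrow> real) \<Rightarrow> 'a) \<Rightarrow> (nat \<Rightarrow> real) set \<Rightarrow>
    ((nat \<Rightarrow> real) \<times> (nat \<Rightarrow> real) \<Rightarrow> 'a) \<Rightarrow> bool" where
  "frame_field q X F \<longleftrightarrow> continuous_map (top_of_set (X \<times> unit_sphere k)) M F \<and>
     (\<forall>x\<in>X. frame (q x) (\<lambda>v. F (x, v)))"

lemma frame_field_subset:
  assumes "frame_field q X F" "Y \<subseteq> X"
  shows "frame_field q Y F"
proof -
  have "continuous_map (subtopology (top_of_set (X \<times> unit_sphere k)) (Y \<times> unit_sphere k)) M F"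
    by (rule continuous_map_from_subtopology) (use assms(1) in \<open>simp add: frame_field_def\<close>)
  moreover have "(X \<times> unit_sphere k) \<inter> (Y \<times> unit_sphere k) = Y \<times> unit_sphere k"
    using assms(2) by blast
  ultimately show ?thesis using assms by (auto simp: frame_field_def subtopology_subtopology)
qed

lemma continuous_map_slice:
  assumes "continuous_map (top_of_set (X \<times> S)) M F" "w \<in> S"
  shows "continuous_map (top_of_set X) M (\<lambda>x. F (x, w))"
proof -
  have "continuous_map (top_of_set X) (top_of_set (X \<times> S)) (\<lambda>x. (x, w))"
    using assms(2) by (auto simp: continuous_map_in_subtopology intro!: continuous_intros)
  from continuous_map_compose[OF this assms(1)] show ?thesis by (simp add: o_def)
qed

text \<open>The sign change between the two fields is locally constant: the sets \<open>C s\<close>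
  on which it can be taken to be \<open>s\<close> are closed, finitely many of them cover
  \<open>X\<close>, and any two are equal or disjoint. Connectedness leaves a single one.\<close>

lemma frame_field_difference:
  assumes X: "connected X" and F: "frame_field q X F" and G: "frame_field q X G"
  obtains s where "\<And>x v. \<lbrakk>x \<in> X; v \<in> unit_sphere k\<rbrakk> \<Longrightarrow> G (x, v) = F (x, flip s v)"
proof (cases "X = {}")
  case True
  then show ?thesis using that by blast
next
  case False
  let ?v = "diagonal_unit k"
  define C where "C s = {x \<in> X. F (x, flip s ?v) = G (x, ?v)}" for s
  have closed: "closedin (top_of_set X) (C s)" for s
  proof -
    have "continuous_map (top_of_set X) M (\<lambda>x. F (x, flip s ?v))"
      "continuous_map (top_of_set X) M (\<lambda>x. G (x, ?v))"
      using F G continuous_map_slice flip_in_unit_sphere[OF diagonal_in] diagonal_in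
      unfolding frame_field_def by blast+
    from closedin_continuous_maps_eq[OF Hausdorff_M this] show ?thesis by (simp add: C_def)
  qed
  \<comment> \<open>Only the first \<open>k\<close> signs matter; taking them from subsets of
    \<open>{..<k}\<close> makes the cover finite.\<close>
  define T where "T = (\<lambda>A i. i \<in> A) ` Pow {..<k}"
  have "finite T" unfolding T_def by simp
  have cover: "\<exists>t\<in>T. x \<in> C t" if x: "x \<in> X" for x
  proof -
    have "frame (q x) (\<lambda>v. F (x, v))" "frame (q x) (\<lambda>v. G (x, v))"
      using F G x unfolding frame_field_def by blast+
    then obtain s where s: "\<And>v. v \<in> unit_sphere k \<Longrightarrow> G (x, v) = F (x, flip s v)"
      by (rule frame_related) (rule that)
    let ?t = "\<lambda>i. i \<in> {i. i < k \<and> s i}"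
    have "flip s ?v = flip ?t ?v" by (rule flip_cong_unit_sphere[OF diagonal_in]) simp
    then have "x \<in> C ?t" using s[OF diagonal_in] x by (simp add: C_def)
    moreover have "?t \<in> T" unfolding T_def by blast
    ultimately show ?thesis by blast
  qed
  \<comment> \<open>A common point forces \<open>s\<close> and \<open>t\<close> to agree up to a
    common sign, a condition that no longer mentions the point.\<close>
  have same: "C s \<subseteq> C t" if "x \<in> C s" "x \<in> C t" for s t x
  proof
    have fr: "frame (q x) (\<lambda>v. F (x, v))" if "x \<in> X" for x
      using F that unfolding frame_field_def by blast
    fix y assume y: "y \<in> C s"
    have "F (x, flip s ?v) = F (x, flip t ?v)" "x \<in> X" "y \<in> X" using that y by (auto simp: C_def)
    from this(1) have "(\<forall>i<k. s i = t i) \<or> (\<forall>i<k. s i \<noteq> t i)"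
      using iffD1[OF frame_diagonal_eq_iff[OF fr[OF \<open>x \<in> X\<close>]]] by simp
    then have "F (y, flip s ?v) = F (y, flip t ?v)"
      using iffD2[OF frame_diagonal_eq_iff[OF fr[OF \<open>y \<in> X\<close>]]] by simp
    then show "y \<in> C t" using y by (simp add: C_def)
  qed
  obtain x0 where x0: "x0 \<in> X" using False by blast
  then obtain s where s: "x0 \<in> C s" using cover by blast
  define E where "E = \<Union>(C ` {t \<in> T. C t \<inter> C s = {}})"
  have "closedin (top_of_set X) E" unfolding E_def using \<open>finite T\<close> closed
    by (intro closedin_Union) auto
  moreover have "E \<union> C s = X"
  proof
    show "E \<union> C s \<subseteq> X" unfolding E_def C_def by blast
    show "X \<subseteq> E \<union> C s"
    proof
      fix x assume "x \<in> X"
      then obtain t where t: "t \<in> T" "x \<in> C t" using cover by blast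
      show "x \<in> E \<union> C s"
      proof (cases "C t \<inter> C s = {}")
        case True
        then show ?thesis using t unfolding E_def by blast
      next
        case False
        then show ?thesis using same t by blast
      qed
    qed
  qed
  moreover have "E \<inter> C s = {}" unfolding E_def by blast
  moreover have "C s \<noteq> {}" using s by blast
  ultimately have "E = {}" using X closed[of s] unfolding connected_closedin_eq by blast
  then have all: "C s = X" using \<open>E \<union> C s = X\<close> by blast
  show ?thesis
  proof (rule that)
    fix x v assume x: "x \<in> X" and v: "v \<in> unit_sphere k"
    have fr: "frame (q x) (\<lambda>v. F (x, v))" "frame (q x) (\<lambda>v. G (x, v))"
      using F G x unfolding frame_field_def by blast+
    then obtain t where t: "\<And>v. v \<in> unit_sphere k \<Longrightarrow> G (x, v) = F (x, flip t v)"
      by (rule frame_related) (rule that)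
    have "x \<in> C s" using all x by simp
    then have "F (x, flip s ?v) = F (x, flip t ?v)" using t[OF diagonal_in] by (simp add: C_def)
    from frame_diagonal_determined[OF fr(1) this v] show "G (x, v) = F (x, flip s v)"
      using t[OF v] by simp
  qed
qed

text \<open>Over the connected overlap the two fields differ by one constant sign change. Applying
  it to \<open>G\<close> over all of \<open>Y\<close> makes them agree there, and they paste along
  closed sets.\<close>

lemma frame_field_glue:
  assumes F: "frame_field q X F" and G: "frame_field q Y G"
    and cl: "closedin (top_of_set (X \<union> Y)) X" "closedin (top_of_set (X \<union> Y)) Y"
    and con: "connected (X \<inter> Y)"
  shows "\<exists>K. frame_field q (X \<union> Y) K"
proof -
  let ?S = "unit_sphere k"
  have "frame_field q (X \<inter> Y) F" "frame_field q (X \<inter> Y) G"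
    using frame_field_subset[OF F] frame_field_subset[OF G] by auto
  from frame_field_difference[OF con this(2,1)] obtain s where
    s: "\<And>x v. \<lbrakk>x \<in> X \<inter> Y; v \<in> ?S\<rbrakk> \<Longrightarrow> F (x, v) = G (x, flip s v)" by blast
  define G' where "G' z = G (fst z, flip s (snd z))" for z
  define K where "K z = (if fst z \<in> X then F z else G' z)" for z
  have "continuous_map (prod_topology (top_of_set Y) (top_of_set ?S)) (prod_topology (top_of_set Y) (top_of_set ?S))
     (\<lambda>z. (fst z, flip s (snd z)))"
    by (intro continuous_map_pairedI continuous_map_fst continuous_map_snd_flip)
  moreover have "continuous_map (prod_topology (top_of_set Y) (top_of_set ?S)) M G"
    using G by (simp add: frame_field_def)
  ultimately have "continuous_map (prod_topology (top_of_set Y) (top_of_set ?S)) M G'"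
    using continuous_map_compose[of _ _ "\<lambda>z. (fst z, flip s (snd z))" M G] unfolding G'_def o_def by blast
  then have G'cont: "continuous_map (top_of_set (Y \<times> ?S)) M G'" by simp
  have "continuous_map (top_of_set ((X \<union> Y) \<times> ?S)) M K"
  proof (rule pasting_lemma_closed[where I = "{True, False}" and
        T = "\<lambda>b. if b then X \<times> ?S else Y \<times> ?S" and f = "\<lambda>b. if b then F else G'"])
    have "subtopology (top_of_set ((X \<union> Y) \<times> ?S)) (X \<times> ?S) = top_of_set (X \<times> ?S)"
      "subtopology (top_of_set ((X \<union> Y) \<times> ?S)) (Y \<times> ?S) = top_of_set (Y \<times> ?S)"
      by (auto simp: subtopology_subtopology Times_Int_Times Int_absorb1)
    then show "continuous_map (subtopology (top_of_set ((X \<union> Y) \<times> ?S)) (if i then X \<times> ?S else Y \<times> ?S)) M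
        (if i then F else G')" for i
      using F G'cont by (simp add: frame_field_def)
    show "closedin (top_of_set ((X \<union> Y) \<times> ?S)) (if i then X \<times> ?S else Y \<times> ?S)" for i
      using cl by (simp add: closedin_Times)
    show "(if i then F else G') z = (if j then F else G') z"
      if "z \<in> topspace (top_of_set ((X \<union> Y) \<times> ?S)) \<inter> (if i then X \<times> ?S else Y \<times> ?S) \<inter> (if j then X \<times> ?S else Y \<times> ?S)"
      for i j z
    proof (cases "i = j")
      case False
      then have "z \<in> (X \<inter> Y) \<times> ?S" using that by (cases i; cases j) auto
      then have "F z = G' z" using s[of "fst z" "snd z"] unfolding G'_def by auto
      then show ?thesis by (cases i; cases j) auto
    qed simp
    show "\<exists>j. j \<in> {True, False} \<and> z \<in> (if j then X \<times> ?S else Y \<times> ?S) \<and> K z = (if j then F else G') z"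
      if "z \<in> topspace (top_of_set ((X \<union> Y) \<times> ?S))" for z
      using that by (intro exI[of _ "fst z \<in> X"]) (auto simp: K_def)
  qed simp
  moreover have "frame (q x) (\<lambda>v. K (x, v))" if x: "x \<in> X \<union> Y" for x
  proof (cases "x \<in> X")
    case True
    then show ?thesis using F unfolding frame_field_def K_def by simp
  next
    case False
    then have "frame (q x) (\<lambda>v. G (x, v))" using G x unfolding frame_field_def by blast
    from frame_flip[OF this, of s] show ?thesis using False unfolding K_def G'_def by simp
  qed
  ultimately show ?thesis unfolding frame_field_def by blast
qed

lemma frame_field_local:
  assumes q: "continuous_map (top_of_set X) B q" and "x \<in> X"
  obtains W F where "open W" "x \<in> W" "frame_field q (X \<inter> W) F"
proof -
  have "q x \<in> topspace B" using q \<open>x \<in> X\<close> by (auto simp: continuous_map_def)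
  then obtain U where U: "U \<in> \<U>" "q x \<in> U" using \<U>_cover by blast
  have "openin (top_of_set X) {y \<in> X. q y \<in> U}"
    using openin_continuous_map_preimage[OF q \<U>_open[OF U(1)]] by simp
  then obtain W where W: "open W" "{y \<in> X. q y \<in> U} = X \<inter> W" unfolding openin_open by blast
  have "continuous_map (top_of_set (X \<inter> W)) B q"
    using continuous_map_from_subtopology[OF q, of W] by (simp add: subtopology_subtopology)
  then have "continuous_map (top_of_set (X \<inter> W)) (subtopology B U) q"
    using W(2) by (auto simp: continuous_map_in_subtopology)
  then have "continuous_map (prod_topology (top_of_set (X \<inter> W)) (top_of_set (unit_sphere k)))
      (prod_topology (subtopology B U) (top_of_set (unit_sphere k))) (\<lambda>z. (q (fst z), snd z))"
    using continuous_map_compose[OF continuous_map_fst, of "top_of_set (X \<inter> W)" _ q]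
    by (intro continuous_map_pairedI continuous_map_snd) (simp add: o_def del: prod_topology_subtopology_eu)
  from continuous_map_compose[OF this H_cont[OF U(1)]]
  have "continuous_map (top_of_set ((X \<inter> W) \<times> unit_sphere k)) M (\<lambda>z. H U (q (fst z), snd z))"
    by (simp add: o_def)
  moreover have "frame (q y) (\<lambda>v. H U (q y, v))" if "y \<in> X \<inter> W" for y
    using frame_local[OF U(1)] that W(2) by blast
  ultimately have "frame_field q (X \<inter> W) (\<lambda>z. H U (q (fst z), snd z))"
    unfolding frame_field_def by simp
  moreover have "x \<in> W" using W(2) \<open>x \<in> X\<close> U(2) by blast
  ultimately show ?thesis using that W(1) by blast
qed

section \<open>Existence of a frame field over the whole cube\<close>

definition slab :: "nat \<Rightarrow> nat \<Rightarrow> (nat \<Rightarrow> real) \<Rightarrow> real \<Rightarrow> (nat \<Rightarrow> real) set" where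
  "slab n d x e = {y \<in> cube n. \<forall>i. d \<le> i \<and> i < n \<longrightarrow> \<bar>y i - x i\<bar> \<le> e}"

text \<open>Coordinate by coordinate, by bisecting the interval of each coordinate.\<close>
lemma frame_field_slab:
  assumes q: "continuous_map (top_of_set (cube n)) B q"
  shows "d \<le> n \<Longrightarrow> x \<in> cube n \<Longrightarrow> \<exists>e>0. \<exists>F. frame_field q (slab n d x e) F"
proof (induction d arbitrary: x)
  case 0
  obtain W F where W: "open W" "x \<in> W" and F: "frame_field q (cube n \<inter> W) F"
    using frame_field_local[OF q 0(2)] .
  have "openin (product_topology (\<lambda>_. euclidean) UNIV) W"
    unfolding euclidean_product_topology using W(1) by simp
  from product_topology_open_contains_basis[OF this W(2)] obtain X where
    X: "x \<in> PiE UNIV X" "\<forall>i. open (X i)" "PiE UNIV X \<subseteq> W" by auto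
  have "\<exists>e>0. \<forall>t. \<bar>t - x i\<bar> \<le> e \<longrightarrow> t \<in> X i" for i
  proof -
    have "x i \<in> X i" using X(1) by auto
    then obtain e where "e > 0" "cball (x i) e \<subseteq> X i" using X(2) open_contains_cball by blast
    then show ?thesis by (intro exI[of _ e]) (auto simp: dist_real_def subset_iff abs_minus_commute)
  qed
  then obtain e where e: "\<And>i. e i > 0" "\<And>i t. \<bar>t - x i\<bar> \<le> e i \<Longrightarrow> t \<in> X i" by metis
  define e0 where "e0 = Min (insert 1 (e ` {..<n}))"
  have "e0 > 0" unfolding e0_def using e(1) by (subst Min_gr_iff) auto
  have e0: "e0 \<le> e i" if "i < n" for i unfolding e0_def using that by (intro Min_le) auto
  have "slab n 0 x e0 \<subseteq> cube n \<inter> W"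
  proof
    fix y assume y: "y \<in> slab n 0 x e0"
    have "y i \<in> X i" for i
    proof (cases "i < n")
      case True
      then have "\<bar>y i - x i\<bar> \<le> e i" using y e0[OF True] unfolding slab_def by fastforce
      then show ?thesis using e(2) by blast
    next
      case False
      then have "y i = x i" using y 0(2) by (auto simp: slab_def cube_def)
      then show ?thesis using X(1) by auto
    qed
    then have "y \<in> PiE UNIV X" by auto
    then show "y \<in> cube n \<inter> W" using X(3) y unfolding slab_def by blast
  qed
  then show ?case using frame_field_subset[OF F] \<open>e0 > 0\<close> by blast
next
  case (Suc d)
  define T where "T a b e = {y \<in> cube n. a \<le> y d \<and> y d \<le> b \<and>
      (\<forall>i. d < i \<and> i < n \<longrightarrow> \<bar>y i - x i\<bar> \<le> e)}" for a b e
  \<comment> \<open>The width \<open>e\<close> in the remaining coordinates may depend on the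
    interval, so that it can shrink whenever two intervals are joined.\<close>
  define P where "P a b \<longleftrightarrow> (\<exists>e>0. \<exists>F. frame_field q (T a b e) F)" for a b
  have closedT: "closedin (top_of_set (T a' b' e)) (T a b e)" if "T a b e \<subseteq> T a' b' e" for a b a' b' e
  proof -
    have "T a b e = T a' b' e \<inter> {y. a \<le> y d} \<inter> {y. y d \<le> b}"
      using that unfolding T_def by auto
    moreover have "closed {y :: nat \<Rightarrow> real. a \<le> y d}" "closed {y :: nat \<Rightarrow> real. y d \<le> b}"
      by (intro closed_Collect_le continuous_intros continuous_on_product_coordinates)+
    ultimately show ?thesis by (metis closedin_closed closed_Int Int_assoc)
  qed
  have "P (-1/4) (1/4)"
  proof (rule Bolzano)
    fix a b c assume "P a b" "P b c" and abc: "a \<le> b" "b \<le> c"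
    then obtain e1 e2 F G where e: "e1 > 0" "e2 > 0"
      and F: "frame_field q (T a b e1) F" and G: "frame_field q (T b c e2) G"
      unfolding P_def by blast
    let ?e = "min e1 e2"
    have sub: "T a b ?e \<subseteq> T a b e1" "T b c ?e \<subseteq> T b c e2" unfolding T_def by fastforce+
    have un: "T a b ?e \<union> T b c ?e = T a c ?e" unfolding T_def using abc by auto
    \<comment> \<open>The overlap is a box, hence connected. Nothing places \<open>b\<close> in the
      range of the coordinate, so the factor in direction \<open>d\<close> may be empty.\<close>
    have "T a b ?e \<inter> T b c ?e = {y. \<forall>i. y i \<in> (if i \<ge> n then {0} else if i < d then {-1/4..1/4}
        else if i = d then {-1/4..1/4} \<inter> {b..b} else {-1/4..1/4} \<inter> {x i - ?e..x i + ?e})}" (is "_ = ?R")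
    proof -
      have "y \<in> T a b ?e \<inter> T b c ?e \<longleftrightarrow> (y \<in> cube n \<and> y d = b \<and> (\<forall>i. d < i \<and> i < n \<longrightarrow> \<bar>y i - x i\<bar> \<le> ?e))" for y
        unfolding T_def using abc by auto
      moreover have "y \<in> ?R \<longleftrightarrow> (y \<in> cube n \<and> y d = b \<and> (\<forall>i. d < i \<and> i < n \<longrightarrow> \<bar>y i - x i\<bar> \<le> ?e))" for y
      proof
        assume y: "y \<in> ?R"
        have "y i \<in> (if i < n then {- 1/4..1/4} else {0})" for i
          using y by (auto dest!: spec[of _ i] split: if_splits)
        moreover have "y d = b" using y Suc(2) by (auto dest!: spec[of _ d])
        moreover have "\<bar>y i - x i\<bar> \<le> ?e" if "d < i" "i < n" for i
        proof -
          have "y i \<in> {x i - ?e..x i + ?e}" using y that by (auto dest!: spec[of _ i])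
          then show ?thesis unfolding atLeastAtMost_iff abs_le_iff by linarith
        qed
        ultimately show "y \<in> cube n \<and> y d = b \<and> (\<forall>i. d < i \<and> i < n \<longrightarrow> \<bar>y i - x i\<bar> \<le> ?e)"
          unfolding cube_alt by blast
      next
        assume y: "y \<in> cube n \<and> y d = b \<and> (\<forall>i. d < i \<and> i < n \<longrightarrow> \<bar>y i - x i\<bar> \<le> ?e)"
        have "y i \<in> {x i - ?e..x i + ?e}" if "d < i" "i < n" for i
        proof -
          have "\<bar>y i - x i\<bar> \<le> ?e" using y that by blast
          then show ?thesis unfolding atLeastAtMost_iff abs_le_iff by linarith
        qed
        then show "y \<in> ?R" using y unfolding cube_def by auto
      qed
      ultimately show ?thesis by blast
    qed
    moreover have "connected ?R"
    proof (rule connected_coordinatewise)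
      have "connected ({-1/4..1/4} \<inter> {u..v :: real})" for u v
        unfolding Int_atLeastAtMost by (rule connected_Icc)
      then show "connected (if i \<ge> n then {0} else if i < d then {-1/4..1/4}
          else if i = d then {-1/4..1/4} \<inter> {b..b} else {-1/4..1/4} \<inter> {x i - ?e..x i + ?e})" for i
        by (simp only: connected_Icc connected_sing split: if_split) simp
    qed
    ultimately have con: "connected (T a b ?e \<inter> T b c ?e)" by simp
    have "\<exists>K. frame_field q (T a b ?e \<union> T b c ?e) K"
      by (rule frame_field_glue[OF frame_field_subset[OF F sub(1)] frame_field_subset[OF G sub(2)] _ _ con])
        (unfold un, (rule closedT, use un in blast)+)
    then show "P a c" unfolding P_def un using e by (intro exI[of _ ?e]) auto
  next
    fix t :: real assume t: "-1/4 \<le> t" "t \<le> 1/4"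
    \<comment> \<open>With the \<open>d\<close>-th coordinate of the centre moved to
      \<open>t\<close>, the induction hypothesis yields a field near \<open>t\<close>; its radius
      \<open>e\<close> bounds the length of the admissible intervals.\<close>
    have "x(d := t) \<in> cube n" using Suc.prems t by (auto simp: cube_def)
    then obtain e F where e: "e > 0" and F: "frame_field q (slab n d (x(d := t)) e) F"
      using Suc.IH Suc.prems by (meson Suc_leD)
    have "P a b" if "a \<le> t \<and> t \<le> b \<and> b - a < e" for a b
    proof -
      have "T a b e \<subseteq> slab n d (x(d := t)) e"
      proof
        fix y assume y: "y \<in> T a b e"
        have "\<bar>y i - (x(d := t)) i\<bar> \<le> e" if "d \<le> i" "i < n" for i
          using y that \<open>a \<le> t \<and> t \<le> b \<and> b - a < e\<close> by (cases "i = d") (auto simp: T_def)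
        then show "y \<in> slab n d (x(d := t)) e" using y by (auto simp: slab_def T_def)
      qed
      then show ?thesis unfolding P_def using frame_field_subset[OF F] e by blast
    qed
    then show "\<exists>e>0. \<forall>a b. a \<le> t \<and> t \<le> b \<and> b - a < e \<longrightarrow> P a b" using e by blast
  qed simp
  then obtain e F where e: "e > 0" and F: "frame_field q (T (-1/4) (1/4) e) F" unfolding P_def by blast
  have "slab n (Suc d) x e \<subseteq> T (-1/4) (1/4) e"
    using Suc.prems(1) by (auto simp: slab_def T_def cube_def)
  then show ?case using frame_field_subset[OF F] e by blast
qed

lemma frame_field_cube:
  assumes q: "continuous_map (top_of_set (cube n)) B q"
  obtains F where "frame_field q (cube n) F"
proof -
  have "(\<lambda>_. 0) \<in> cube n" by (simp add: cube_def)
  then obtain e F where "frame_field q (slab n n (\<lambda>_. 0) e) F"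
    using frame_field_slab[OF q order_refl] by blast
  moreover have "slab n n (\<lambda>_. 0) e = cube n" by (auto simp: slab_def)
  ultimately show ?thesis using that by simp
qed

end

section \<open>The cube as a hemisphere\<close>

text \<open>The sup norm of the first \<open>m\<close> coordinates. Its value 0 for
  \<open>m = 0\<close> covers the projectivization of a single line bundle, whose fibre is a
  point.\<close>

fun coord_max :: "nat \<Rightarrow> (nat \<Rightarrow> real) \<Rightarrow> real" where
  "coord_max 0 u = 0"
| "coord_max (Suc m) u = max (coord_max m u) \<bar>u m\<bar>"

lemma coord_max_nonneg: "coord_max m u \<ge> 0"
  by (induction m) auto

lemma abs_le_coord_max: "i < m \<Longrightarrow> \<bar>u i\<bar> \<le> coord_max m u"
  by (induction m) (auto simp: less_Suc_eq le_max_iff_disj)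

lemma coord_max_le: "\<lbrakk>c \<ge> 0; \<And>i. i < m \<Longrightarrow> \<bar>u i\<bar> \<le> c\<rbrakk> \<Longrightarrow> coord_max m u \<le> c"
  by (induction m) auto

lemma coord_max_attained: "coord_max m u \<noteq> 0 \<Longrightarrow> \<exists>i<m. \<bar>u i\<bar> = coord_max m u"
proof (induction m)
  case (Suc m)
  show ?case
  proof (cases "coord_max m u \<le> \<bar>u m\<bar>")
    case True
    then show ?thesis by (intro exI[of _ m]) simp
  next
    case False
    then have "coord_max (Suc m) u = coord_max m u" by simp
    then show ?thesis using Suc by (metis less_Suc_eq)
  qed
qed simp

lemma coord_max_cong: "(\<And>i. i < m \<Longrightarrow> \<bar>u i\<bar> = \<bar>w i\<bar>) \<Longrightarrow> coord_max m u = coord_max m w"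
  by (induction m) auto

lemma coord_max_scale: "a \<ge> 0 \<Longrightarrow> coord_max m (\<lambda>i. a * u i) = a * coord_max m u"
  by (induction m) (auto simp: abs_mult max_mult_distrib_left)

lemma coord_max_flip: "coord_max m (flip s u) = coord_max m u"
  by (rule coord_max_cong) (simp add: flip_apply)

lemma continuous_map_coord_max:
  "(\<And>i. i < m \<Longrightarrow> continuous_map X euclideanreal (\<lambda>x. f x i)) \<Longrightarrow>
     continuous_map X euclideanreal (\<lambda>x. coord_max m (f x))"
  by (induction m) (auto intro!: continuous_map_real_max continuous_map_real_abs)

text \<open>The graph of \<open>1/4 - max |u i|\<close> over the cube; radial projection identifies it with the
  upper hemisphere, compatibly with sign changes.\<close>
definition roof :: "nat \<Rightarrow> (nat \<Rightarrow> real) \<Rightarrow> nat \<Rightarrow> real" where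
  "roof m u = (\<lambda>i. if i < m then u i else if i = m then 1/4 - coord_max m u else 0)"

definition dome :: "nat \<Rightarrow> (nat \<Rightarrow> real) \<Rightarrow> nat \<Rightarrow> real" where
  "dome m u = normalize_vec (Suc m) (roof m u)"

lemma coord_max_roof: "coord_max m (roof m u) = coord_max m u"
  by (rule coord_max_cong) (simp add: roof_def)

text \<open>If the first \<open>m\<close> coordinates vanish, so does \<open>coord_max\<close>, and
  the height is \<open>1/4\<close>.\<close>

lemma roof_nonzero: "\<exists>i<Suc m. roof m u i \<noteq> 0"
proof (rule ccontr)
  assume "\<not> ?thesis"
  then have 0: "roof m u i = 0" if "i < Suc m" for i using that by blast
  then have "coord_max m (roof m u) \<le> 0" by (intro coord_max_le) auto
  then show False using 0[of m] coord_max_nonneg[of m u] unfolding coord_max_roof by (simp add: roof_def)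
qed

lemma coord_max_cube_le: "u \<in> cube m \<Longrightarrow> coord_max m u \<le> 1/4"
  by (intro coord_max_le) (auto simp: cube_def abs_le_iff)

lemma dome_in_unit_sphere: "dome m u \<in> unit_sphere (Suc m)"
proof -
  obtain i where "i < Suc m" "roof m u i \<noteq> 0" using roof_nonzero by blast
  then show ?thesis unfolding dome_def
    by (intro normalize_vec_in_unit_sphere) (auto simp: roof_def)
qed

lemma dome_eq_scaled_roof: obtains a where "a > 0" "dome m u = (\<lambda>i. a * roof m u i)"
proof -
  obtain i where i: "i < Suc m" "roof m u i \<noteq> 0" using roof_nonzero by blast
  show ?thesis
  proof (rule that)
    show "inverse (sqrt (\<Sum>i<Suc m. (roof m u i)\<^sup>2)) > 0"
      using sum_squares_pos[of i "Suc m" "roof m u"] i by simp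
    show "dome m u = (\<lambda>j. inverse (sqrt (\<Sum>i<Suc m. (roof m u i)\<^sup>2)) * roof m u j)"
      by (simp only: dome_def normalize_vec_def divide_inverse mult.commute)
  qed
qed

lemma dome_last_nonneg: "u \<in> cube m \<Longrightarrow> dome m u m \<ge> 0"
proof -
  assume "u \<in> cube m"
  then have "roof m u m \<ge> 0" using coord_max_cube_le[of u m] by (simp add: roof_def)
  moreover obtain a where "a > 0" "dome m u = (\<lambda>i. a * roof m u i)" by (rule dome_eq_scaled_roof)
  ultimately show ?thesis by simp
qed

text \<open>For points of the cube: the equator corresponds to the boundary of the cube, the only
  place where antipodal points both lie in the hemisphere.\<close>

lemma dome_last_eq_0_iff: "dome m u m = 0 \<longleftrightarrow> coord_max m u = 1/4"
proof -
  obtain a where "a > 0" "dome m u = (\<lambda>i. a * roof m u i)" by (rule dome_eq_scaled_roof)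
  then show ?thesis by (auto simp: roof_def)
qed

text \<open>The scaling factor can be read off from the image: height plus sup norm of the other
  coordinates is \<open>1/4\<close> at every point of the roof and scales linearly.\<close>

lemma dome_inj:
  assumes "u \<in> cube m" "w \<in> cube m" "dome m u = dome m w"
  shows "u = w"
proof -
  obtain a where a: "a > 0" "dome m u = (\<lambda>i. a * roof m u i)" by (rule dome_eq_scaled_roof)
  obtain b where b: "b > 0" "dome m w = (\<lambda>i. b * roof m w i)" by (rule dome_eq_scaled_roof)
  have eq: "a * roof m u i = b * roof m w i" for i using a b assms(3) by metis
  have "a * coord_max m u = b * coord_max m w"
    using coord_max_scale[of a m "roof m u"] coord_max_scale[of b m "roof m w"] a b eq
    by (simp add: coord_max_roof)
  moreover have "a * (1/4 - coord_max m u) = b * (1/4 - coord_max m w)"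
    using eq[of m] by (simp add: roof_def)
  ultimately have "a = b" by (simp add: algebra_simps)
  show ?thesis
  proof
    fix i show "u i = w i"
    proof (cases "i < m")
      case True
      then show ?thesis using eq[of i] \<open>a = b\<close> a by (simp add: roof_def)
    next
      case False
      then show ?thesis using assms(1,2) by (simp add: cube_def)
    qed
  qed
qed

lemma dome_surj:
  assumes v: "v \<in> unit_sphere (Suc m)" "v m \<ge> 0"
  shows "\<exists>u\<in>cube m. dome m u = v"
proof -
  \<comment> \<open>On the roof this quantity is \<open>1/4\<close>, so the ray through
    \<open>v\<close> meets the roof at the factor \<open>1 / (4 * L)\<close>.\<close>
  define L where "L = v m + coord_max m v"
  have "L > 0"
  proof -
    obtain i where "i < Suc m" "v i \<noteq> 0" using unit_sphere_nonzero[OF v(1)] .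
    then show ?thesis using abs_le_coord_max[of i m v] coord_max_nonneg[of m v] v(2)
      unfolding L_def by (cases "i = m") (fastforce simp: less_Suc_eq)+
  qed
  define t where "t = 1 / (4 * L)"
  have "t > 0" "t * L = 1/4" using \<open>L > 0\<close> by (simp_all add: t_def)
  then have t: "t > 0" "t * v m + t * coord_max m v = 1/4"
    by (simp_all add: L_def distrib_left)
  define u where "u i = (if i < m then t * v i else 0)" for i
  have cm: "coord_max m u = t * coord_max m v"
    using coord_max_scale[of t m v] coord_max_cong[of m u "\<lambda>i. t * v i"] t(1) by (simp add: u_def)
  have ub: "\<bar>u i\<bar> \<le> 1/4" for i
  proof (cases "i < m")
    case True
    have "t * v m \<ge> 0" using t(1) v(2) by simp
    then show ?thesis using abs_le_coord_max[OF True, of u] t(2) cm by linarith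
  qed (simp add: u_def)
  have "- 1/4 \<le> u i \<and> u i \<le> 1/4" for i using ub[of i] by linarith
  moreover have "u i = 0" if "i \<ge> m" for i using that by (simp add: u_def)
  ultimately have "u \<in> cube m" unfolding cube_def by blast
  moreover have "roof m u = (\<lambda>i. t * v i)"
  proof
    fix i
    show "roof m u i = t * v i"
      using t(2) v(1) cm by (cases i m rule: linorder_cases) (auto simp: roof_def u_def unit_sphere_def)
  qed
  then have "dome m u = v"
    using normalize_vec_pos_scale[OF t(1), of "Suc m" v] normalize_vec_unit[OF v(1)] by (simp add: dome_def)
  ultimately show ?thesis by blast
qed

text \<open>The height depends only on absolute values, so flips of the other coordinates pass
  through. This is the use of normalizing the signs at the last line bundle: a flip of coordinate
  \<open>m\<close> would leave the hemisphere.\<close>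

lemma dome_flip: "\<not> s m \<Longrightarrow> dome m (flip s u) = flip s (dome m u)"
proof -
  assume "\<not> s m"
  then have "roof m (flip s u) = flip s (roof m u)"
    by (auto simp: roof_def flip_def fun_eq_iff coord_max_flip[unfolded flip_def])
  then show ?thesis by (simp add: dome_def normalize_vec_flip)
qed

lemma dome_antipode:
  assumes "coord_max m u = 1/4"
  shows "dome m (\<lambda>i. - u i) = (\<lambda>i. - dome m u i)"
proof -
  have "coord_max m (\<lambda>i. - u i) = 1/4" using assms coord_max_cong[of m "\<lambda>i. - u i" u] by simp
  then have "roof m (\<lambda>i. - u i) = (\<lambda>i. - roof m u i)" using assms by (auto simp: roof_def)
  then show ?thesis by (simp add: dome_def normalize_vec_uminus)
qed

section \<open>Splitting the coordinates of the cube\<close>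

definition base_part :: "nat \<Rightarrow> (nat \<Rightarrow> real) \<Rightarrow> nat \<Rightarrow> real" where
  "base_part n z = (\<lambda>i. if i < n then z i else 0)"

definition fibre_part :: "nat \<Rightarrow> (nat \<Rightarrow> real) \<Rightarrow> nat \<Rightarrow> real" where
  "fibre_part n z = (\<lambda>i. z (n + i))"

definition join_parts :: "nat \<Rightarrow> (nat \<Rightarrow> real) \<Rightarrow> (nat \<Rightarrow> real) \<Rightarrow> nat \<Rightarrow> real" where
  "join_parts n x u = (\<lambda>i. if i < n then x i else u (i - n))"

lemma base_part_in_cube: "z \<in> cube (n + m) \<Longrightarrow> base_part n z \<in> cube n"
  by (simp add: cube_def base_part_def)

lemma fibre_part_in_cube: "z \<in> cube (n + m) \<Longrightarrow> fibre_part n z \<in> cube m"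
  by (simp add: cube_def fibre_part_def)

lemma join_parts_in_cube: "x \<in> cube n \<Longrightarrow> u \<in> cube m \<Longrightarrow> join_parts n x u \<in> cube (n + m)"
  by (simp add: cube_def join_parts_def)

lemma join_base_fibre [simp]: "join_parts n (base_part n z) (fibre_part n z) = z"
  by (auto simp: join_parts_def base_part_def fibre_part_def)

lemma base_join [simp]: "x \<in> cube n \<Longrightarrow> base_part n (join_parts n x u) = x"
  by (auto simp: join_parts_def base_part_def cube_def)

lemma fibre_join [simp]: "fibre_part n (join_parts n x u) = u"
  by (auto simp: join_parts_def fibre_part_def)

text \<open>With the diagonal filled, the row of a fibre coordinate is one on the new block and zero
  before it: its pairing is the antipodal map of the fibre cube. An old pairing acts on the fibre
  cube by the comparison signs \<open>s\<close>.\<close>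

definition extend_matrix :: "nat \<Rightarrow> (nat \<Rightarrow> nat \<Rightarrow> bool) \<Rightarrow> (nat \<Rightarrow> nat \<Rightarrow> bool) \<Rightarrow> nat \<Rightarrow> nat \<Rightarrow> bool" where
  "extend_matrix n A s j i \<longleftrightarrow> (if j < n then if i < n then A j i else s j (i - n) else n \<le> i \<and> i \<noteq> j)"

lemma tau_row_extend_matrix:
  "j < n \<Longrightarrow> tau_row (extend_matrix n A s) j i \<longleftrightarrow> (if i < n then tau_row A j i else s j (i - n))"
  "n \<le> j \<Longrightarrow> tau_row (extend_matrix n A s) j i \<longleftrightarrow> n \<le> i"
  by (auto simp: tau_row_def extend_matrix_def)

lemma tau_extend_join:
  "fst j < n \<Longrightarrow> tau (extend_matrix n A s) j (join_parts n x u) = join_parts n (tau A j x) (flip (s (fst j)) u)"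
  "n \<le> fst j \<Longrightarrow> tau (extend_matrix n A s) j (join_parts n x u) = join_parts n x (\<lambda>i. - u i)"
  by (auto simp: tau_eq_flip flip_def tau_row_extend_matrix join_parts_def fun_eq_iff)

lemma join_in_facet_iff:
  assumes "x \<in> cube n" "u \<in> cube m"
  shows "fst j < n \<Longrightarrow> join_parts n x u \<in> facet (n + m) j \<longleftrightarrow> x \<in> facet n j"
    and "n \<le> fst j \<Longrightarrow> join_parts n x u \<in> facet (n + m) j \<longleftrightarrow> u (fst j - n) = (if snd j then 1/4 else - 1/4)"
  using assms join_parts_in_cube[OF assms] by (auto simp: facet_def join_parts_def)

lemma block_triangular_extend_matrix:
  assumes A: "block_triangular n A bl"
    and s: "\<And>i j l. \<lbrakk>i < n; j < n; bl i = bl j; l < m\<rbrakk> \<Longrightarrow> s i l = s j l"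
  shows "block_triangular (n + m) (extend_matrix n A s) (\<lambda>i. if i < n then bl i else Suc (\<Sum>i<n. bl i))"
proof -
  \<comment> \<open>The label of the new block only has to exceed all old labels; one more than
    their sum does.\<close>
  have lt: "bl i < Suc (\<Sum>i<n. bl i)" if "i < n" for i
    using member_le_sum[of i "{..<n}" bl] that by simp
  let ?bl = "\<lambda>i. if i < n then bl i else Suc (\<Sum>i<n. bl i)"
  have 1: "tau_row (extend_matrix n A s) i l = tau_row (extend_matrix n A s) j l"
    if ij: "?bl i = ?bl j" and l: "l < n + m" for i j l
  proof (cases "i < n")
    case True
    then have j: "j < n" and eq: "bl i = bl j" using ij lt[of i] by (auto split: if_splits)
    show ?thesis
    proof (cases "l < n")
      case True
      then have "tau_row A i l = tau_row A j l"
        using A \<open>i < n\<close> j eq unfolding block_triangular_def by blast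
      then show ?thesis using True \<open>i < n\<close> j by (simp add: tau_row_extend_matrix)
    next
      case False
      then show ?thesis using s[of i j "l - n"] \<open>i < n\<close> j eq l by (simp add: tau_row_extend_matrix)
    qed
  next
    case False
    then have "\<not> j < n" using ij lt[of j] by (auto split: if_splits)
    then show ?thesis using False by (simp add: tau_row_extend_matrix)
  qed
  have 2: "\<not> extend_matrix n A s i j" if "?bl j < ?bl i" for i j
  proof (cases "i < n")
    case True
    then have "j < n" "bl j < bl i" using that lt[of i] by (auto split: if_splits)
    then show ?thesis using A True unfolding block_triangular_def extend_matrix_def by auto
  next
    case False
    then have "j < n" using that by (auto split: if_splits)
    then show ?thesis using False by (simp add: extend_matrix_def)
  qed
  show ?thesis unfolding block_triangular_def using 1 2 by blast
qed

section \<open>The pairing relation\<close>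

text \<open>The pairing at the opposite facet inverts a pairing, so the generating steps are already
  symmetric.\<close>

lemma pair_rel_alt:
  "pair_rel n A = Id_on (cube n) \<union> {(x, tau A j x) | x j. fst j < n \<and> x \<in> facet n j}\<^sup>+"
proof -
  let ?S = "{(x, tau A j x) | x j. fst j < n \<and> x \<in> facet n j}"
  have "?S\<inverse> \<subseteq> ?S"
  proof
    fix z assume "z \<in> ?S\<inverse>"
    then obtain x j where z: "z = (tau A j x, x)" and j: "fst j < n" "x \<in> facet n j" by blast
    have "z = (tau A j x, tau A (opp j) (tau A j x))" unfolding z tau_tau ..
    moreover have "fst (opp j) < n" using j(1) by simp
    ultimately show "z \<in> ?S"
      unfolding mem_Collect_eq using tau_in_facet[OF j(2), of A] by (intro exI conjI)
  qed
  then have "?S \<union> ?S\<inverse> = ?S" by blast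
  then show ?thesis unfolding pair_rel_def Let_def by simp
qed

lemma pair_rel_refl: "x \<in> cube n \<Longrightarrow> (x, x) \<in> pair_rel n A"
  unfolding pair_rel_alt by blast

lemma pair_rel_step:
  assumes "(x, y) \<in> pair_rel n A" "fst j < n" "y \<in> facet n j"
  shows "(x, tau A j y) \<in> pair_rel n A"
proof -
  let ?S = "{(x, tau A j x) | x j. fst j < n \<and> x \<in> facet n j}"
  have st: "(y, tau A j y) \<in> ?S" using assms(2,3) by blast
  from assms(1) consider "x = y" | "(x, y) \<in> ?S\<^sup>+" unfolding pair_rel_alt by blast
  then have "(x, tau A j y) \<in> ?S\<^sup>+"
  proof cases
    case 1
    then show ?thesis using st by (simp add: r_into_trancl)
  next
    case 2
    then show ?thesis using st by (rule trancl_into_trancl)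
  qed
  then show ?thesis unfolding pair_rel_alt by blast
qed

lemma pair_rel_induct [consumes 1, case_names refl step]:
  assumes "(x, y) \<in> pair_rel n A"
    and refl: "x \<in> cube n \<Longrightarrow> P x"
    and step: "\<And>y j. \<lbrakk>y \<in> cube n; P y; fst j < n; y \<in> facet n j\<rbrakk> \<Longrightarrow> P (tau A j y)"
  shows "P y"
proof -
  let ?S = "{(x, tau A j x) | x j. fst j < n \<and> x \<in> facet n j}"
  have fc: "facet n j \<subseteq> cube n" for j by (auto simp: facet_def)
  from assms(1) consider "x = y" "x \<in> cube n" | "(x, y) \<in> ?S\<^sup>+" unfolding pair_rel_alt by blast
  then show ?thesis
  proof cases
    case 1
    then show ?thesis using refl by simp
  next
    case 2
    then show ?thesis
    proof (induction rule: trancl_induct)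
      case (base y)
      then obtain j where j: "y = tau A j x" "fst j < n" "x \<in> facet n j" by blast
      then have "x \<in> cube n" using fc by blast
      then show ?case using step refl j by blast
    next
      case (step y z)
      then obtain j where j: "z = tau A j y" "fst j < n" "y \<in> facet n j" by blast
      then have "y \<in> cube n" using fc by blast
      then show ?case using assms(3) step.IH j by blast
    qed
  qed
qed

text \<open>No quotient topology is demanded: a continuous surjection from the compact cube onto a
  Hausdorff space is a quotient map anyway. This keeps the property easy to pass on to the total
  space.\<close>

definition seal_param :: "nat \<Rightarrow> (nat \<Rightarrow> nat \<Rightarrow> bool) \<Rightarrow> 'a topology \<Rightarrow> ((nat \<Rightarrow> real) \<Rightarrow> 'a) \<Rightarrow> bool" where
  "seal_param n A B q \<longleftrightarrow> continuous_map (top_of_set (cube n)) B q \<and> q ` cube n = topspace B \<and>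
     (\<forall>x\<in>cube n. \<forall>y\<in>cube n. q x = q y \<longleftrightarrow> (x, y) \<in> pair_rel n A)"

section \<open>The total space over a parametrized base\<close>

lemma seal_param_tau:
  assumes "seal_param n A B q" "fst j < n" "x \<in> facet n j"
  shows "q (tau A j x) = q x"
proof -
  have x: "x \<in> cube n" "tau A j x \<in> cube n"
    using assms(3) tau_in_facet[OF assms(3), of A] by (auto simp: facet_def)
  have "(x, tau A j x) \<in> pair_rel n A" using pair_rel_step[OF pair_rel_refl[OF x(1)] assms(2,3)] .
  then show ?thesis using assms(1) x unfolding seal_param_def by metis
qed

lemma compact_space_seal_param: "seal_param n A B q \<Longrightarrow> compact_space B"
proof -
  assume q: "seal_param n A B q"
  have "compactin (top_of_set (cube n)) (cube n)" by (simp add: compactin_subtopology compact_cube)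
  then have "compactin B (q ` cube n)" using image_compactin q unfolding seal_param_def by blast
  then show ?thesis using q unfolding seal_param_def compact_space_def by simp
qed

context sign_bundle
begin

lemma k_eq: "Suc (k - 1) = k"
  using k_pos by simp

text \<open>As \<open>q\<close> agrees at paired points, transporting \<open>F\<close> by the
  pairing gives a second frame field along the same \<open>q\<close> over the facet; since the facet
  is connected, the two differ by a constant sign change.\<close>

lemma facet_signs:
  assumes q: "seal_param n A B q" and F: "frame_field q (cube n) F" and j: "j < n"
  shows "\<exists>s. \<not> s (k - 1) \<and> (\<forall>b. \<forall>x\<in>facet n (j, b). \<forall>v\<in>unit_sphere k.
    F (tau A (j, b) x, v) = F (x, flip s v))"
proof -
  let ?S = "unit_sphere k" and ?X = "facet n (j, True)" and ?t = "tau A (j, True)"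
  have XC: "?X \<subseteq> cube n" by (auto simp: facet_def)
  have tX: "?t x \<in> cube n" if "x \<in> ?X" for x
    using tau_in_facet[OF that, of A] by (simp add: facet_def)
  define G where "G z = F (?t (fst z), snd z)" for z
  have FX: "frame_field q ?X F" using frame_field_subset[OF F XC] .
  have "continuous_map (top_of_set ?X) (top_of_set (cube n)) ?t"
    unfolding continuous_map_into_fun
  proof (intro conjI allI)
    show "continuous_map (top_of_set ?X) euclideanreal (\<lambda>x. ?t x i)" for i
      by (cases "tau_row A j i") (simp_all only: tau_eq_flip flip_apply fst_conv if_True if_False
          continuous_map_coord continuous_map_minus)
    show "?t ` topspace (top_of_set ?X) \<subseteq> cube n" using tX by auto
  qed
  from continuous_map_compose[OF continuous_map_fst this]
  have "continuous_map (prod_topology (top_of_set ?X) (top_of_set ?S)) (top_of_set (cube n)) (\<lambda>z. ?t (fst z))"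
    unfolding o_def .
  then have "continuous_map (prod_topology (top_of_set ?X) (top_of_set ?S))
      (prod_topology (top_of_set (cube n)) (top_of_set ?S)) (\<lambda>z. (?t (fst z), snd z))"
    by (intro continuous_map_pairedI continuous_map_snd)
  moreover have "continuous_map (prod_topology (top_of_set (cube n)) (top_of_set ?S)) M F"
    using F by (simp add: frame_field_def)
  ultimately have "continuous_map (prod_topology (top_of_set ?X) (top_of_set ?S)) M G"
    using continuous_map_compose[of _ _ "\<lambda>z. (?t (fst z), snd z)" M F] unfolding G_def o_def by blast
  moreover have "frame (q x) (\<lambda>v. G (x, v))" if "x \<in> ?X" for x
  proof -
    have "frame (q (?t x)) (\<lambda>v. F (?t x, v))" using F tX[OF that] unfolding frame_field_def by blast
    then show ?thesis using seal_param_tau[OF q _ that] j unfolding G_def by simp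
  qed
  ultimately have "frame_field q ?X G" unfolding frame_field_def by simp
  from frame_field_difference[OF connected_facet FX this] j
  obtain s0 where s0: "\<And>x v. \<lbrakk>x \<in> ?X; v \<in> ?S\<rbrakk> \<Longrightarrow> G (x, v) = F (x, flip s0 v)" by auto
  \<comment> \<open>Multiplying by the common sign \<open>s0 (k - 1)\<close> changes no value in the
    projectivized fibre.\<close>
  define s where "s i \<longleftrightarrow> s0 i \<noteq> s0 (k - 1)" for i
  have s: "F (?t x, v) = F (x, flip s v)" if x: "x \<in> ?X" and v: "v \<in> ?S" for x v
  proof -
    have fr: "frame (q x) (\<lambda>v. F (x, v))" using FX x unfolding frame_field_def by blast
    have "flip s v = flip s0 v \<or> flip s v = (\<lambda>i. - flip s0 v i)"
      unfolding s_def flip_def by (cases "s0 (k - 1)") auto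
    then have "F (x, flip s0 v) = F (x, flip s v)"
      using frame_eq_iff[OF fr flip_in_unit_sphere[OF v] flip_in_unit_sphere[OF v]] by blast
    then show ?thesis using s0[OF x v] by (simp add: G_def)
  qed
  show ?thesis
  proof (intro exI[of _ s] conjI allI ballI)
    show "\<not> s (k - 1)" by (simp add: s_def)
    fix b x v assume x: "x \<in> facet n (j, b)" and v: "v \<in> ?S"
    show "F (tau A (j, b) x, v) = F (x, flip s v)"
    proof (cases b)
      case True
      then show ?thesis using s x v by simp
    next
      case False
      \<comment> \<open>Opposite facets share one formula for the pairing, and it is an involution,
        so the signs found on one facet serve the other.\<close>
      have t: "tau A (j, b) = ?t" by (simp add: tau_eq_flip)
      have "?t x \<in> ?X" using tau_in_facet[OF x, of A] False unfolding t by (simp add: opp_def)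
      from s[OF this flip_in_unit_sphere[OF v, of s]] have "F (?t (?t x), flip s v) = F (?t x, v)" by simp
      moreover have "?t (?t x) = x" by (simp add: tau_eq_flip)
      ultimately show ?thesis unfolding t by simp
    qed
  qed
qed

end

section \<open>Parametrization of the total space by the larger cube\<close>

locale seal_frame = sign_bundle M B k p \<U> H
  for M B :: "'a topology" and k p \<U> H +
  fixes n A and q :: "(nat \<Rightarrow> real) \<Rightarrow> 'a" and F and s :: "nat \<Rightarrow> nat \<Rightarrow> bool"
  assumes param: "seal_param n A B q" and field: "frame_field q (cube n) F"
    and s_last: "i < n \<Longrightarrow> \<not> s i (k - 1)"
    and F_tau: "\<lbrakk>fst j < n; x \<in> facet n j; v \<in> unit_sphere k\<rbrakk> \<Longrightarrow>
      F (tau A j x, v) = F (x, flip (s (fst j)) v)"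
begin

text \<open>Every point of a projectivized fibre has a representative in the closed upper
  hemisphere, unique off the equator. The base coordinates select the fibre and its frame, the
  others the point of the hemisphere.\<close>

definition Q :: "(nat \<Rightarrow> real) \<Rightarrow> 'a" where
  "Q z = F (base_part n z, dome (k - 1) (fibre_part n z))"

lemma Q_join: "x \<in> cube n \<Longrightarrow> Q (join_parts n x u) = F (x, dome (k - 1) u)"
  by (simp add: Q_def)

lemma frame_F: "x \<in> cube n \<Longrightarrow> frame (q x) (\<lambda>v. F (x, v))"
  using field unfolding frame_field_def by blast

lemma dome_in: "dome (k - 1) u \<in> unit_sphere k"
  using dome_in_unit_sphere[of "k - 1" u] unfolding k_eq .

lemma s_eq_of_rows:
  assumes ij: "i < n" "j < n" and rows: "\<And>l. l < n \<Longrightarrow> tau_row A i l = tau_row A j l" and "l < k"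
  shows "s i l = s j l"
proof -
  define x where "x l = (if l = i \<or> l = j then 1/4 else 0 :: real)" for l
  have x: "x \<in> cube n" "x \<in> facet n (i, True)" "x \<in> facet n (j, True)"
    using ij by (auto simp: x_def cube_def facet_def)
  have "tau A (i, True) x = tau A (j, True) x"
  proof
    fix l
    show "tau A (i, True) x l = tau A (j, True) x l"
    proof (cases "l < n")
      case True
      then show ?thesis using rows by (simp add: tau_eq_flip flip_apply)
    next
      case False
      then have "x l = 0" using ij by (auto simp: x_def)
      then show ?thesis by (simp add: tau_eq_flip flip_apply)
    qed
  qed
  then have "F (x, flip (s i) (diagonal_unit k)) = F (x, flip (s j) (diagonal_unit k))"
    using F_tau[of "(i, True)" x "diagonal_unit k"] F_tau[of "(j, True)" x "diagonal_unit k"]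
      ij x diagonal_in by simp
  from iffD1[OF frame_diagonal_eq_iff[OF frame_F[OF x(1)]] this]
  have "(\<forall>l<k. s i l = s j l) \<or> (\<forall>l<k. s i l \<noteq> s j l)" .
  \<comment> \<open>The diagonal vector determines the signs only up to a common factor; the
    normalization at \<open>k - 1\<close> excludes the second alternative.\<close>
  moreover have "k - 1 < k" "s i (k - 1) = s j (k - 1)" using s_last ij k_pos by auto
  ultimately show ?thesis using \<open>l < k\<close> by blast
qed

lemma Q_continuous: "continuous_map (top_of_set (cube (n + (k - 1)))) M Q"
proof -
  let ?C = "top_of_set (cube (n + (k - 1)))"
  have coord: "continuous_map ?C euclideanreal (\<lambda>z. z i)" for i
    by (rule continuous_map_coord)
  have "continuous_map ?C (top_of_set (cube n)) (base_part n)"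
    unfolding continuous_map_into_fun
  proof (intro conjI allI)
    show "continuous_map ?C euclideanreal (\<lambda>z. base_part n z i)" for i
      using coord by (cases "i < n") (simp_all add: base_part_def)
    show "base_part n ` topspace ?C \<subseteq> cube n" using base_part_in_cube by auto
  qed
  moreover have "continuous_map ?C (top_of_set (unit_sphere (Suc (k - 1))))
      (\<lambda>z. normalize_vec (Suc (k - 1)) (roof (k - 1) (fibre_part n z)))"
  proof (rule continuous_map_normalize_vec)
    fix j
    show "continuous_map ?C euclideanreal (\<lambda>z. roof (k - 1) (fibre_part n z) j)"
    proof (cases j "k - 1" rule: linorder_cases)
      case less
      then show ?thesis using coord by (simp add: roof_def fibre_part_def)
    next
      case equal
      have "continuous_map ?C euclideanreal (\<lambda>z. coord_max (k - 1) (fibre_part n z))"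
        by (rule continuous_map_coord_max) (use coord in \<open>simp add: fibre_part_def\<close>)
      then have "continuous_map ?C euclideanreal (\<lambda>z. 1/4 - coord_max (k - 1) (fibre_part n z))"
        by (intro continuous_map_diff) auto
      then show ?thesis using equal by (simp add: roof_def)
    next
      case greater
      then show ?thesis by (simp add: roof_def)
    qed
    show "roof (k - 1) (fibre_part n z) j = 0" if "j \<ge> Suc (k - 1)" for z
      using that by (simp add: roof_def)
    show "\<exists>j<Suc (k - 1). roof (k - 1) (fibre_part n z) j \<noteq> 0" for z by (rule roof_nonzero)
  qed
  then have "continuous_map ?C (top_of_set (unit_sphere k)) (\<lambda>z. dome (k - 1) (fibre_part n z))"
    unfolding dome_def k_eq .
  ultimately have "continuous_map ?C (prod_topology (top_of_set (cube n)) (top_of_set (unit_sphere k)))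
      (\<lambda>z. (base_part n z, dome (k - 1) (fibre_part n z)))"
    by (intro continuous_map_pairedI)
  moreover have "continuous_map (prod_topology (top_of_set (cube n)) (top_of_set (unit_sphere k))) M F"
    using field by (simp add: frame_field_def)
  ultimately have "continuous_map ?C M (F \<circ> (\<lambda>z. (base_part n z, dome (k - 1) (fibre_part n z))))"
    by (rule continuous_map_compose)
  then show ?thesis unfolding o_def Q_def .
qed

lemma Q_image: "Q ` cube (n + (k - 1)) = topspace M"
proof
  show "Q ` cube (n + (k - 1)) \<subseteq> topspace M"
    using continuous_map_image_subset_topspace[OF Q_continuous] by simp
  show "topspace M \<subseteq> Q ` cube (n + (k - 1))"
  proof
    fix y assume y: "y \<in> topspace M"
    then have "p y \<in> topspace B" using p_cont by (auto simp: continuous_map_def)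
    then obtain x where x: "x \<in> cube n" "q x = p y" using param unfolding seal_param_def by (metis imageE)
    obtain v where v: "v \<in> unit_sphere k" "F (x, v) = y"
      using frame_surj[OF frame_F[OF x(1)] y] x(2) by auto
    have neg: "F (x, \<lambda>i. - v i) = F (x, v)"
      using frame_eq_iff[OF frame_F[OF x(1)] v(1) uminus_in_unit_sphere[OF v(1)]] by simp
    \<comment> \<open>Of the two antipodal representatives at least one lies in the upper
      hemisphere.\<close>
    define w where "w = (if v (k - 1) \<ge> 0 then v else (\<lambda>i. - v i))"
    have w: "w \<in> unit_sphere k" "w (k - 1) \<ge> 0" "F (x, w) = y"
      using v uminus_in_unit_sphere[OF v(1)] neg by (auto simp: w_def)
    then obtain u where u: "u \<in> cube (k - 1)" "dome (k - 1) u = w"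
      using dome_surj[of w "k - 1"] unfolding k_eq by blast
    have "Q (join_parts n x u) = y" using Q_join[OF x(1)] u w by simp
    then show "y \<in> Q ` cube (n + (k - 1))" using join_parts_in_cube[OF x(1) u(1)] by blast
  qed
qed

text \<open>At an old facet the flip of the dome cancels the flip between the frames. At a fibre
  facet the fibre coordinates lie on the boundary of their cube, so the dome moves to its antipode,
  which is the same projective point.\<close>

lemma Q_tau:
  assumes z: "z \<in> facet (n + (k - 1)) j" and j: "fst j < n + (k - 1)"
  shows "Q (tau (extend_matrix n A s) j z) = Q z"
proof -
  define x u where "x = base_part n z" and "u = fibre_part n z"
  have zc: "z \<in> cube (n + (k - 1))" using z by (simp add: facet_def)
  have xu: "x \<in> cube n" "u \<in> cube (k - 1)" "z = join_parts n x u"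
    unfolding x_def u_def using base_part_in_cube[OF zc] fibre_part_in_cube[OF zc] by simp_all
  show ?thesis
  proof (cases "fst j < n")
    case True
    then have xf: "x \<in> facet n j" using z join_in_facet_iff(1)[OF xu(1,2)] unfolding xu(3) by blast
    have "tau A j x \<in> cube n" using tau_in_facet[OF xf, of A] by (simp add: facet_def)
    then have "Q (tau (extend_matrix n A s) j z) = F (tau A j x, dome (k - 1) (flip (s (fst j)) u))"
      unfolding xu(3) tau_extend_join(1)[OF True] by (rule Q_join)
    also have "dome (k - 1) (flip (s (fst j)) u) = flip (s (fst j)) (dome (k - 1) u)"
      using s_last[OF True] by (rule dome_flip)
    also have "F (tau A j x, \<dots>) = F (x, dome (k - 1) u)"
      using F_tau[OF True xf flip_in_unit_sphere[OF dome_in]] by simp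
    finally show ?thesis using Q_join[OF xu(1)] xu(3) by simp
  next
    case False
    then have j': "n \<le> fst j" by simp
    have uj: "u (fst j - n) = (if snd j then 1/4 else - 1/4)"
      using z join_in_facet_iff(2)[OF xu(1,2) j'] unfolding xu(3) by blast
    then have "\<bar>u (fst j - n)\<bar> = 1/4" by simp
    moreover have "fst j - n < k - 1" using j j' by simp
    ultimately have "coord_max (k - 1) u = 1/4"
      using abs_le_coord_max[of "fst j - n" "k - 1" u] coord_max_cube_le[OF xu(2)] by simp
    then have "dome (k - 1) (\<lambda>i. - u i) = (\<lambda>i. - dome (k - 1) u i)" by (rule dome_antipode)
    moreover have "F (x, \<lambda>i. - dome (k - 1) u i) = F (x, dome (k - 1) u)"
      using frame_eq_iff[OF frame_F[OF xu(1)] dome_in[of u] uminus_in_unit_sphere[OF dome_in[of u]]] by simp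
    ultimately show ?thesis unfolding xu(3) tau_extend_join(2)[OF j'] by (simp add: Q_join[OF xu(1)])
  qed
qed

lemma Q_eq_of_pair_rel:
  assumes "(z, w) \<in> pair_rel (n + (k - 1)) (extend_matrix n A s)"
  shows "Q z = Q w"
  using assms
proof (induction rule: pair_rel_induct)
  case (step y j)
  then show ?case using Q_tau[OF step(3,2)] by simp
qed simp

text \<open>Path lifting: each pairing of the small cube is followed by the pairing of the large
  cube with the same signed index, at the cost of a sign change of the fibre coordinates.\<close>

lemma pair_rel_lift:
  assumes "(x, y) \<in> pair_rel n A" "u \<in> cube (k - 1)"
  shows "y \<in> cube n \<and> (\<exists>u'\<in>cube (k - 1).
    (join_parts n x u, join_parts n y u') \<in> pair_rel (n + (k - 1)) (extend_matrix n A s))"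
  using assms(1)
proof (induction rule: pair_rel_induct)
  case refl
  then show ?case using pair_rel_refl[OF join_parts_in_cube[OF refl assms(2)]] assms(2) by blast
next
  case (step y j)
  then obtain u' where u': "u' \<in> cube (k - 1)"
    "(join_parts n x u, join_parts n y u') \<in> pair_rel (n + (k - 1)) (extend_matrix n A s)" by blast
  have "join_parts n y u' \<in> facet (n + (k - 1)) j"
    using join_in_facet_iff(1)[OF step(1) u'(1) step(2)] step(3) by blast
  from pair_rel_step[OF u'(2) _ this] step(2)
  have "(join_parts n x u, join_parts n (tau A j y) (flip (s (fst j)) u'))
      \<in> pair_rel (n + (k - 1)) (extend_matrix n A s)"
    by (simp add: tau_extend_join(1))
  moreover have "tau A j y \<in> cube n" using tau_in_facet[OF step(3), of A] by (simp add: facet_def)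
  ultimately show ?case using flip_in_cube[OF u'(1)] by blast
qed

text \<open>Applying \<open>p\<close> shows that the base points are equivalent; lifting this
  equivalence from \<open>z\<close> leaves a comparison inside the fibre over \<open>y\<close>.
  There the two hemisphere points are equal or antipodal, and antipodal ones lie on the equator,
  where one fibre pairing joins them.\<close>

lemma pair_rel_of_Q_eq:
  assumes z: "z \<in> cube (n + (k - 1))" and w: "w \<in> cube (n + (k - 1))" and eq: "Q z = Q w"
  shows "(z, w) \<in> pair_rel (n + (k - 1)) (extend_matrix n A s)"
proof -
  define x y where "x = base_part n z" and "y = base_part n w"
  have xy: "x \<in> cube n" "y \<in> cube n" unfolding x_def y_def using base_part_in_cube z w by blast+
  have fz: "fibre_part n z \<in> cube (k - 1)" and fw: "fibre_part n w \<in> cube (k - 1)"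
    using fibre_part_in_cube z w by blast+
  have "p (Q z) = q x" "p (Q w) = q y"
    unfolding Q_def x_def[symmetric] y_def[symmetric] using frame_p[OF frame_F dome_in] xy by blast+
  then have "(x, y) \<in> pair_rel n A" using eq param xy unfolding seal_param_def by metis
  from pair_rel_lift[OF this fz] obtain u where u: "u \<in> cube (k - 1)"
    and rel: "(z, join_parts n y u) \<in> pair_rel (n + (k - 1)) (extend_matrix n A s)"
    unfolding x_def by auto
  let ?v = "fibre_part n w"
  have wj: "w = join_parts n y ?v" unfolding y_def by simp
  have "F (y, dome (k - 1) u) = F (y, dome (k - 1) ?v)"
    using Q_eq_of_pair_rel[OF rel] eq Q_join[OF xy(2)] unfolding Q_def[of w] y_def[symmetric] by simp
  then consider "dome (k - 1) ?v = dome (k - 1) u" | "dome (k - 1) ?v = (\<lambda>i. - dome (k - 1) u i)"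
    using iffD1[OF frame_eq_iff[OF frame_F[OF xy(2)] dome_in dome_in]] by blast
  then show ?thesis
  proof cases
    case 1
    then have "?v = u" using dome_inj[OF fw u] by simp
    then show ?thesis using rel wj by simp
  next
    case 2
    have "dome (k - 1) u (k - 1) = 0"
      using dome_last_nonneg[OF u] dome_last_nonneg[OF fw] unfolding 2 by simp
    then have cm: "coord_max (k - 1) u = 1/4" unfolding dome_last_eq_0_iff .
    have "(\<lambda>i. - u i) \<in> cube (k - 1)" using flip_in_cube[OF u, of "\<lambda>_. True"] by (simp add: flip_def)
    then have v: "?v = (\<lambda>i. - u i)"
      using dome_inj[OF fw] 2 dome_antipode[OF cm] by simp
    obtain i where i: "i < k - 1" "\<bar>u i\<bar> = 1/4" using coord_max_attained[of "k - 1" u] cm by auto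
    \<comment> \<open>The sup norm \<open>1/4\<close> is attained at \<open>i\<close>, and the sign
      of \<open>u i\<close> selects the facet.\<close>
    define j where "j = (n + i, u i > 0)"
    have j: "n \<le> fst j" "fst j < n + (k - 1)" using i(1) by (simp_all add: j_def)
    have "join_parts n y u \<in> facet (n + (k - 1)) j"
      using join_in_facet_iff(2)[OF xy(2) u j(1)] i(2) by (auto simp: j_def)
    from pair_rel_step[OF rel j(2) this] show ?thesis
      unfolding tau_extend_join(2)[OF j(1)] using wj v by simp
  qed
qed

lemma seal_param_Q: "seal_param (n + (k - 1)) (extend_matrix n A s) M Q"
  unfolding seal_param_def using Q_continuous Q_image Q_eq_of_pair_rel pair_rel_of_Q_eq by blast

end

text \<open>The induction hypothesis along the tower. Compactness is not listed because it follows
  from the surjection of the cube; the Hausdorff property does not and has to be carried.\<close>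

definition seal_realized :: "nat \<Rightarrow> 'a topology \<Rightarrow> bool" where
  "seal_realized n M \<longleftrightarrow> Hausdorff_space M \<and>
     (\<exists>A bl q. (\<forall>i<n. \<not> A i i) \<and> block_triangular n A bl \<and> seal_param n A M q)"

lemma seal_realized_proj_whitney_bundle:
  assumes B: "seal_realized n B" and pw: "proj_whitney_bundle M B k p"
  shows "seal_realized (n + (k - 1)) M"
proof -
  obtain A bl q where diag: "\<forall>i<n. \<not> A i i" and A: "block_triangular n A bl" and q: "seal_param n A B q"
    and "Hausdorff_space B" using B unfolding seal_realized_def by blast
  then obtain \<U> H where "sign_bundle M B k p \<U> H"
    using sign_bundle_of_proj_whitney_bundle[OF pw compact_space_seal_param[OF q]] by blast
  then interpret sign_bundle M B k p \<U> H .
  have "continuous_map (top_of_set (cube n)) B q" using q unfolding seal_param_def by blast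
  then obtain F where F: "frame_field q (cube n) F" by (rule frame_field_cube)
  have "\<forall>j\<in>{..<n}. \<exists>s. \<not> s (k - 1) \<and> (\<forall>b. \<forall>x\<in>facet n (j, b). \<forall>v\<in>unit_sphere k.
      F (tau A (j, b) x, v) = F (x, flip s v))"
    using facet_signs[OF q F] by simp
  from bchoice[OF this] obtain s where s: "\<forall>j\<in>{..<n}. \<not> s j (k - 1) \<and>
      (\<forall>b. \<forall>x\<in>facet n (j, b). \<forall>v\<in>unit_sphere k. F (tau A (j, b) x, v) = F (x, flip (s j) v))" ..
  interpret seal_frame M B k p \<U> H n A q F s
  proof
    show "seal_param n A B q" "frame_field q (cube n) F" by fact+
    show "\<not> s j (k - 1)" if "j < n" for j using s that by simp
    show "F (tau A j x, v) = F (x, flip (s (fst j)) v)"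
      if "fst j < n" "x \<in> facet n j" "v \<in> unit_sphere k" for j x v
    proof -
      have "\<forall>b. \<forall>x\<in>facet n (fst j, b). \<forall>v\<in>unit_sphere k. F (tau A (fst j, b) x, v) = F (x, flip (s (fst j)) v)"
        using s that(1) by simp
      from spec[OF this, of "snd j"] show ?thesis using that(2,3) by simp
    qed
  qed
  have "block_triangular (n + (k - 1)) (extend_matrix n A s)
      (\<lambda>i. if i < n then bl i else Suc (\<Sum>i<n. bl i))"
  proof (rule block_triangular_extend_matrix[OF A])
    fix i j l assume ij: "i < n" "j < n" "bl i = bl j" and l: "l < k - 1"
    show "s i l = s j l"
    proof (rule s_eq_of_rows[OF ij(1,2)])
      show "tau_row A i l = tau_row A j l" if "l < n" for l
        using A ij that unfolding block_triangular_def by blast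
      show "l < k" using l by simp
    qed
  qed
  moreover have "\<forall>i<n + (k - 1). \<not> extend_matrix n A s i i"
    using diag by (simp add: extend_matrix_def)
  ultimately show ?thesis unfolding seal_realized_def using Hausdorff_M seal_param_Q by blast
qed

lemma cube_0: "cube 0 = {\<lambda>_. 0}"
  by (auto simp: cube_def)

lemma seal_realized_point:
  assumes "topspace B = {pt}"
  shows "seal_realized 0 B"
proof -
  have "seal_param 0 (\<lambda>_ _. False) B (\<lambda>_. pt)"
    unfolding seal_param_def cube_0 using assms pair_rel_refl[of "\<lambda>_. 0" 0] by (simp add: cube_0)
  moreover have "Hausdorff_space B" unfolding Hausdorff_space_def using assms by auto
  ultimately show ?thesis unfolding seal_realized_def block_triangular_def by blast
qed

section \<open>The seal space\<close>

lemma pair_rel_in_cube: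
  assumes "(x, y) \<in> pair_rel n A"
  shows "x \<in> cube n" "y \<in> cube n"
proof -
  have fc: "facet n j \<subseteq> cube n" for j by (auto simp: facet_def)
  show "x \<in> cube n"
  proof -
    from assms consider "x \<in> cube n" | "(x, y) \<in> {(x, tau A j x) | x j. fst j < n \<and> x \<in> facet n j}\<^sup>+"
      unfolding pair_rel_alt by blast
    then show ?thesis
    proof cases
      case 2
      from tranclD[OF this] show ?thesis using fc by blast
    qed
  qed
  show "y \<in> cube n"
    using assms by (induction rule: pair_rel_induct) (use tau_in_facet fc in blast)+
qed

text \<open>Both spaces carry the quotient topology of the cube for the same partition:
  \<open>M\<close> because \<open>q\<close> maps a compact space onto a Hausdorff one, the seal
  space by definition.\<close>

lemma seal_space_homeomorphic:
  assumes "Hausdorff_space M" and q: "seal_param n A M q"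
  shows "seal_space n A homeomorphic_space M"
proof -
  let ?C = "cube n" and ?E = "cube n // pair_rel n A"
  have qm: "quotient_map (top_of_set ?C) M q"
    using q assms(1) unfolding seal_param_def
    by (intro continuous_imp_quotient_map) (simp_all add: compact_space_subtopology compact_cube)
  have qC: "q x \<in> topspace M" if "x \<in> ?C" for x using q that unfolding seal_param_def by blast
  define fib where "fib y = {x \<in> ?C. q x = y}" for y
  have cls: "pair_rel n A `` {x} = fib (q x)" if "x \<in> ?C" for x
    using q that pair_rel_in_cube(2) unfolding seal_param_def fib_def by fastforce
  have E: "?E = fib ` topspace M"
  proof -
    have "?E = (\<lambda>x. fib (q x)) ` ?C" unfolding quotient_def using cls by auto
    also have "\<dots> = fib ` q ` ?C" by blast
    finally show ?thesis using q unfolding seal_param_def by simp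
  qed
  have mem: "c = fib (q x)" if "c \<in> ?E" "x \<in> c" for c x
    using that unfolding E fib_def by auto
  have UnE: "\<Union>?E = ?C"
  proof
    show "\<Union>?E \<subseteq> ?C" unfolding E fib_def by blast
    show "?C \<subseteq> \<Union>?E" unfolding E fib_def using qC by blast
  qed
  let ?P = "\<lambda>S. S \<subseteq> ?E \<and> openin (top_of_set ?C) (\<Union>S)"
  \<comment> \<open>\<open>seal_space\<close> is given through \<open>topology\<close>, whose open
    sets are the prescribed ones only once the axioms are checked. Intersections work because the
    classes are disjoint.\<close>
  have "istopology ?P"
    unfolding istopology_def
  proof (intro conjI allI impI)
    fix S T assume S: "?P S" and T: "?P T"
    show "S \<inter> T \<subseteq> ?E" using S by blast
    have "\<Union>S \<inter> \<Union>T \<subseteq> \<Union>(S \<inter> T)"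
    proof
      fix x assume "x \<in> \<Union>S \<inter> \<Union>T"
      then obtain c d where "c \<in> S" "x \<in> c" "d \<in> T" "x \<in> d" by blast
      moreover have "c = fib (q x)" "d = fib (q x)" using calculation mem S T by blast+
      ultimately show "x \<in> \<Union>(S \<inter> T)" by blast
    qed
    then have "\<Union>(S \<inter> T) = \<Union>S \<inter> \<Union>T" by blast
    then show "openin (top_of_set ?C) (\<Union>(S \<inter> T))" using S T openin_Int by metis
  next
    fix K assume K: "\<forall>S\<in>K. ?P S"
    show "\<Union>K \<subseteq> ?E" using K by blast
    have "\<Union>(\<Union>K) = \<Union>(Union ` K)" by blast
    moreover have "openin (top_of_set ?C) (\<Union>(Union ` K))" by (rule openin_Union) (use K in blast)
    ultimately show "openin (top_of_set ?C) (\<Union>(\<Union>K))" by simp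
  qed
  then have op: "openin (seal_space n A) S \<longleftrightarrow> ?P S" for S
    unfolding seal_space_def by (simp add: topology_inverse')
  have top: "topspace (seal_space n A) = ?E"
  proof
    show "topspace (seal_space n A) \<subseteq> ?E" using op[of "topspace (seal_space n A)"] by simp
    have "openin (seal_space n A) ?E" unfolding op UnE by (simp add: openin_subtopology_self)
    then show "?E \<subseteq> topspace (seal_space n A)" by (rule openin_subset)
  qed
  have "homeomorphic_map M (seal_space n A) fib"
    unfolding homeomorphic_map_def quotient_map_def
  proof (intro conjI allI impI)
    show "fib ` topspace M = topspace (seal_space n A)" unfolding top E ..
    show "inj_on fib (topspace M)"
    proof (rule inj_onI)
      fix y y' assume y: "y \<in> topspace M" "y' \<in> topspace M" "fib y = fib y'"
      obtain x where "x \<in> ?C" "q x = y" using q y(1) unfolding seal_param_def by (metis imageE)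
      then have "x \<in> fib y'" using y(3) unfolding fib_def by blast
      then show "y = y'" using \<open>q x = y\<close> unfolding fib_def by simp
    qed
    fix S assume S: "S \<subseteq> topspace (seal_space n A)"
    let ?W = "{y \<in> topspace M. fib y \<in> S}"
    have "{x \<in> ?C. q x \<in> ?W} = \<Union>S"
    proof
      show "{x \<in> ?C. q x \<in> ?W} \<subseteq> \<Union>S" unfolding fib_def by blast
      show "\<Union>S \<subseteq> {x \<in> ?C. q x \<in> ?W}"
      proof
        fix x assume "x \<in> \<Union>S"
        then obtain c where c: "c \<in> S" "x \<in> c" by blast
        then have "c \<in> ?E" using S top by blast
        then have "c = fib (q x)" "x \<in> ?C" using mem c(2) UnE by blast+
        then show "x \<in> {x \<in> ?C. q x \<in> ?W}" using qC c(1) by simp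
      qed
    qed
    moreover have "openin (top_of_set ?C) {x \<in> ?C. q x \<in> ?W} \<longleftrightarrow> openin M ?W"
    proof -
      have "?W \<subseteq> topspace M" by blast
      then show ?thesis using spec[OF conjunct2[OF qm[unfolded quotient_map_def]], of ?W] by simp
    qed
    ultimately show "openin M ?W \<longleftrightarrow> openin (seal_space n A) S"
      unfolding op using S top by simp
  qed
  then show ?thesis using homeomorphic_map_imp_homeomorphic_space homeomorphic_space_sym by blast
qed

theorem mainTheorem17:
  fixes M :: "'a topology" and n :: nat
  assumes "gen_real_bott n M"
  shows "\<exists>A :: nat \<Rightarrow> nat \<Rightarrow> bool. (\<forall>i<n. \<not> A i i) \<and> strong_pairing n A \<and>
           seal_space n A homeomorphic_space M"
proof -
  from assms obtain m and B :: "nat \<Rightarrow> 'a topology" and k p pt where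
    pt: "topspace (B 0) = {pt}" and M: "B m = M"
    and pw: "\<forall>i<m. proj_whitney_bundle (B (Suc i)) (B i) (k i) (p i)" and n: "n = (\<Sum>i<m. k i - 1)"
    unfolding gen_real_bott_def by blast
  have "l \<le> m \<Longrightarrow> seal_realized (\<Sum>i<l. k i - 1) (B l)" for l
  proof (induction l)
    case 0
    then show ?case using seal_realized_point[OF pt] by simp
  next
    case (Suc l)
    then have "proj_whitney_bundle (B (Suc l)) (B l) (k l) (p l)" using pw by simp
    from seal_realized_proj_whitney_bundle[OF _ this] Suc show ?case by simp
  qed
  then have "seal_realized n M" using M n by blast
  then obtain A bl q where "Hausdorff_space M" "\<forall>i<n. \<not> A i i" "block_triangular n A bl" "seal_param n A M q"
    unfolding seal_realized_def by blast
  then show ?thesis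
    using strong_pairing_of_block_triangular seal_space_homeomorphic by blast
qed

end
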